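(* Let $(R,\mathfrak m)$ be a standard graded integral domain over a field of any characteristic, with irrelevant ideal $\mathfrak m$, and let $\mathfrak p$ be a nonzero homogeneous prime ideal of $R$ with $\dim R/\mathfrak p=1$. Then $\gamma(\mathfrak p)\ge\alpha(\mathfrak p)-d(\mathfrak p)$.
   Context: For a nonzero homogeneous ideal $I$, $\alpha(I):=\min\{n:I_n\ne0\}$. The $n$-th symbolic power is $I^{(n)}:=\bigcap_{\mathfrak q\in\operatorname{Ass}(R/I)}(I^nR_{\mathfrak q}\cap R)$. The Waldschmidt constant is $\gamma(I):=\lim_{n\to\infty}\alpha(I^{(n)})/n$ (this limit exists). $d(I):=\inf\{b\in\mathbb N_0:\mathfrak m^{bn}H^0_{\mathfrak m}(R/I^n)=0\ \text{for all } n\gg0\}$, where $H^0_{\mathfrak m}(M)$ is the submodule of elements of $M$ annihilated by some power of $\mathfrak m$. *)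

theory Defs
  imports
    "HOL-Algebra.Ideal_Product"
    "HOL-Algebra.Generated_Rings"
    "HOL-Algebra.Module"
    "HOL-Library.Extended_Real"
begin

section \<open>Standard graded algebras\<close>

text \<open>
  The base field is identified with the subfield \<open>K\<close> of \<open>R\<close>, which is the degree \<open>0\<close> component.
  "Standard graded" means: finitely generated as a \<open>K\<close>-algebra by elements of degree \<open>1\<close>.
\<close>

locale standard_graded_algebra = cring R for R (structure) +
  fixes K :: "'a set" and gr :: "nat \<Rightarrow> 'a set"
  assumes subfield_K: "subfield K R"
    and gr_subgroup: "additive_subgroup (gr n) R"
    and gr_mult: "a \<in> gr m \<Longrightarrow> b \<in> gr n \<Longrightarrow> a \<otimes> b \<in> gr (m + n)"
    and gr_decomp: "r \<in> carrier R \<Longrightarrow>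
      \<exists>!f. (\<forall>n. f n \<in> gr n) \<and> finite {n. f n \<noteq> \<zero>} \<and> r = (\<Oplus>n\<in>{n. f n \<noteq> \<zero>}. f n)"
    and gr_0: "gr 0 = K"
    and gr_1_generates: "\<exists>X. finite X \<and> X \<subseteq> gr 1 \<and> generate_ring R (K \<union> X) = carrier R"

definition irrelevant_ideal :: "('a, 'b) ring_scheme \<Rightarrow> (nat \<Rightarrow> 'a set) \<Rightarrow> 'a set" where
  "irrelevant_ideal R gr = genideal R (\<Union>n\<in>{1..}. gr n)"

definition homogeneous_ideal :: "('a, 'b) ring_scheme \<Rightarrow> (nat \<Rightarrow> 'a set) \<Rightarrow> 'a set \<Rightarrow> bool" where
  "homogeneous_ideal R gr I \<longleftrightarrow> ideal I R \<and> I = genideal R (I \<inter> (\<Union>n. gr n))"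

text \<open>The initial degree \<open>\<alpha>(I)\<close>; meaningful for nonzero homogeneous \<open>I\<close>.\<close>

definition initial_degree :: "('a, 'b) ring_scheme \<Rightarrow> (nat \<Rightarrow> 'a set) \<Rightarrow> 'a set \<Rightarrow> nat" where
  "initial_degree R gr I = (LEAST n. I \<inter> gr n \<noteq> {\<zero>\<^bsub>R\<^esub>})"

primrec ideal_power :: "('a, 'b) ring_scheme \<Rightarrow> 'a set \<Rightarrow> nat \<Rightarrow> 'a set" where
  "ideal_power R I 0 = carrier R"
| "ideal_power R I (Suc n) = ideal_prod R I (ideal_power R I n)"


section \<open>Krull dimension\<close>

text \<open>
  The supremum of the lengths \<open>n\<close> of chains \<open>P 0 \<subset> \<dots> \<subset> P n\<close> of prime ideals.
  The zero ring has no prime ideal and gets dimension \<open>0\<close> here.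
\<close>

definition krull_dim :: "('a, 'b) ring_scheme \<Rightarrow> enat" where
  "krull_dim R = Sup {enat n | n. \<exists>P :: nat \<Rightarrow> 'a set.
     (\<forall>i\<le>n. primeideal (P i) R) \<and> (\<forall>i<n. P i \<subset> P (Suc i))}"


section \<open>Quotients as modules, associated primes, local cohomology\<close>

text \<open>\<open>R/I\<close> as an \<open>R\<close>-module, extending the record of the quotient ring.\<close>

definition quotient_module :: "('a, 'b) ring_scheme \<Rightarrow> 'a set \<Rightarrow> ('a, 'a set) module" where
  "quotient_module R I = ring.extend (R Quot I)
     \<lparr>smult = (\<lambda>r X. (I +>\<^bsub>R\<^esub> r) \<otimes>\<^bsub>R Quot I\<^esub> X)\<rparr>"

definition associated_primes ::
    "('a, 'b) ring_scheme \<Rightarrow> ('a, 'm, 'c) module_scheme \<Rightarrow> 'a set set" where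
  "associated_primes R M = {P. primeideal P R \<and>
     (\<exists>x\<in>carrier M. P = {r \<in> carrier R. r \<odot>\<^bsub>M\<^esub> x = \<zero>\<^bsub>M\<^esub>})}"

text \<open>\<open>H\<^sup>0\<^sub>J(M)\<close>: the elements of \<open>M\<close> annihilated by some power of the ideal \<open>J\<close>.\<close>

definition local_cohomology_0 ::
    "('a, 'b) ring_scheme \<Rightarrow> 'a set \<Rightarrow> ('a, 'm, 'c) module_scheme \<Rightarrow> 'm set" where
  "local_cohomology_0 R J M =
     {x \<in> carrier M. \<exists>k. \<forall>r\<in>ideal_power R J k. r \<odot>\<^bsub>M\<^esub> x = \<zero>\<^bsub>M\<^esub>}"

text \<open>
  \<open>d(I)\<close>. It is the infimum of a set of natural numbers taken in \<^typ>\<open>enat\<close>, so that the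
  infimum of the empty set is \<open>\<infinity>\<close> (on \<^typ>\<open>nat\<close> it would be the junk value \<open>0\<close>).
\<close>

definition sat_slope :: "('a, 'b) ring_scheme \<Rightarrow> (nat \<Rightarrow> 'a set) \<Rightarrow> 'a set \<Rightarrow> enat" where
  "sat_slope R gr I = Inf {enat b | b. \<forall>\<^sub>F n in sequentially.
     let J = irrelevant_ideal R gr; M = quotient_module R (ideal_power R I n)
     in \<forall>r\<in>ideal_power R J (b * n). \<forall>x\<in>local_cohomology_0 R J M. r \<odot>\<^bsub>M\<^esub> x = \<zero>\<^bsub>M\<^esub>}"


section \<open>Rings of fractions\<close>

definition frac_rel ::
    "('a, 'b) ring_scheme \<Rightarrow> 'a set \<Rightarrow> (('a \<times> 'a) \<times> ('a \<times> 'a)) set" where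
  "frac_rel R S = {((a, s), (b, t)). a \<in> carrier R \<and> s \<in> S \<and> b \<in> carrier R \<and> t \<in> S \<and>
     (\<exists>u\<in>S. u \<otimes>\<^bsub>R\<^esub> (a \<otimes>\<^bsub>R\<^esub> t) = u \<otimes>\<^bsub>R\<^esub> (b \<otimes>\<^bsub>R\<^esub> s))}"

text \<open>The fraction \<open>a/s\<close>.\<close>

definition fraction :: "('a, 'b) ring_scheme \<Rightarrow> 'a set \<Rightarrow> 'a \<Rightarrow> 'a \<Rightarrow> ('a \<times> 'a) set" where
  "fraction R S a s = frac_rel R S `` {(a, s)}"

definition frac_ring :: "('a, 'b) ring_scheme \<Rightarrow> 'a set \<Rightarrow> ('a \<times> 'a) set ring" where
  "frac_ring R S =
    \<lparr>carrier = (carrier R \<times> S) // frac_rel R S,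
     mult = (\<lambda>X Y. \<Union>(a, s)\<in>X. \<Union>(b, t)\<in>Y. fraction R S (a \<otimes>\<^bsub>R\<^esub> b) (s \<otimes>\<^bsub>R\<^esub> t)),
     one = fraction R S \<one>\<^bsub>R\<^esub> \<one>\<^bsub>R\<^esub>,
     zero = fraction R S \<zero>\<^bsub>R\<^esub> \<one>\<^bsub>R\<^esub>,
     add = (\<lambda>X Y. \<Union>(a, s)\<in>X. \<Union>(b, t)\<in>Y.
       fraction R S (a \<otimes>\<^bsub>R\<^esub> t \<oplus>\<^bsub>R\<^esub> b \<otimes>\<^bsub>R\<^esub> s) (s \<otimes>\<^bsub>R\<^esub> t))\<rparr>"

definition localization :: "('a, 'b) ring_scheme \<Rightarrow> 'a set \<Rightarrow> ('a \<times> 'a) set ring" where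
  "localization R q = frac_ring R (carrier R - q)"

definition to_localization :: "('a, 'b) ring_scheme \<Rightarrow> 'a set \<Rightarrow> 'a \<Rightarrow> ('a \<times> 'a) set" where
  "to_localization R q r = fraction R (carrier R - q) r \<one>\<^bsub>R\<^esub>"

text \<open>\<open>J R\<^sub>q \<inter> R\<close>: the preimage in \<open>R\<close> of the ideal of \<open>R\<^sub>q\<close> generated by the image of \<open>J\<close>.\<close>

definition extend_contract :: "('a, 'b) ring_scheme \<Rightarrow> 'a set \<Rightarrow> 'a set \<Rightarrow> 'a set" where
  "extend_contract R q J = {r \<in> carrier R.
     to_localization R q r \<in> genideal (localization R q) (to_localization R q ` J)}"


section \<open>Symbolic powers and the Waldschmidt constant\<close>

text \<open>Intersecting with \<open>carrier R\<close> matters only if there is no associated prime.\<close>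

definition symbolic_power :: "('a, 'b) ring_scheme \<Rightarrow> 'a set \<Rightarrow> nat \<Rightarrow> 'a set" where
  "symbolic_power R I n = carrier R \<inter>
     (\<Inter>q\<in>associated_primes R (quotient_module R I). extend_contract R q (ideal_power R I n))"

definition waldschmidt :: "('a, 'b) ring_scheme \<Rightarrow> (nat \<Rightarrow> 'a set) \<Rightarrow> 'a set \<Rightarrow> real" where
  "waldschmidt R gr I = lim (\<lambda>n. real (initial_degree R gr (symbolic_power R I n)) / real n)"


section \<open>The constructions above yield modules and rings\<close>

lemma quotient_module_simps [simp]:
  "carrier (quotient_module R I) = carrier (R Quot I)"
  "zero (quotient_module R I) = zero (R Quot I)"
  "add (quotient_module R I) = add (R Quot I)"
  "mult (quotient_module R I) = mult (R Quot I)"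
  "one (quotient_module R I) = one (R Quot I)"
  "smult (quotient_module R I) r X = (I +>\<^bsub>R\<^esub> r) \<otimes>\<^bsub>R Quot I\<^esub> X"
  by (simp_all add: quotient_module_def ring.defs)

lemma quotient_module_is_module:
  assumes "cring R" "ideal I R"
  shows "module R (quotient_module R I)"
proof -
  interpret I: ideal I R by fact
  interpret R: cring R by fact
  interpret Q: cring "R Quot I" by (rule I.quotient_is_cring[OF assms(1)])
  interpret h: ring_hom_ring R "R Quot I" "(+>\<^bsub>R\<^esub>) I" by (rule I.rcos_ring_hom_ring)
  have inv: "\<exists>Y\<in>carrier (R Quot I). Y \<oplus>\<^bsub>R Quot I\<^esub> X = \<zero>\<^bsub>R Quot I\<^esub>"
    if "X \<in> carrier (R Quot I)" for X
    using Q.l_neg[OF that] Q.a_inv_closed[OF that] by (rule bexI)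
  show ?thesis
  proof (rule moduleI)
    show "abelian_group (quotient_module R I)"
      by (rule abelian_groupI; simp only: quotient_module_simps)
        (rule Q.a_closed Q.zero_closed Q.a_assoc Q.a_comm Q.l_zero inv;
         assumption)+
  qed (use assms in \<open>auto simp: Q.l_distr Q.r_distr Q.m_assoc\<close>)
qed

context cring
begin

context
  fixes S assumes S: "submonoid S R"
begin

private lemma S_simps [simp]: "s \<in> S \<Longrightarrow> s \<in> carrier R" "\<one> \<in> S"
    "s \<in> S \<Longrightarrow> t \<in> S \<Longrightarrow> s \<otimes> t \<in> S"
  using submonoid.subset[OF S] submonoid.one_closed[OF S] submonoid.m_closed[OF S] by auto

lemma equiv_frac_rel: "equiv (carrier R \<times> S) (frac_rel R S)"
proof (rule equivI)
  show "frac_rel R S \<subseteq> (carrier R \<times> S) \<times> (carrier R \<times> S)"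
    by (auto simp: frac_rel_def)
  show "refl_on (carrier R \<times> S) (frac_rel R S)"
    by (auto simp: refl_on_def frac_rel_def)
  show "sym (frac_rel R S)"
    by (auto simp: sym_def frac_rel_def) metis
  show "trans (frac_rel R S)"
  proof (rule transI, clarify)
    fix a s b t c w
    assume "((a, s), (b, t)) \<in> frac_rel R S" "((b, t), (c, w)) \<in> frac_rel R S"
    then obtain u v where *: "a \<in> carrier R" "s \<in> S" "b \<in> carrier R" "t \<in> S" "c \<in> carrier R" "w \<in> S"
      "u \<in> S" "v \<in> S" "u \<otimes> (a \<otimes> t) = u \<otimes> (b \<otimes> s)" "v \<otimes> (b \<otimes> w) = v \<otimes> (c \<otimes> t)"
      by (auto simp: frac_rel_def)
    note c = S_simps(1)[OF \<open>s \<in> S\<close>] S_simps(1)[OF \<open>t \<in> S\<close>] S_simps(1)[OF \<open>w \<in> S\<close>]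
      S_simps(1)[OF \<open>u \<in> S\<close>] S_simps(1)[OF \<open>v \<in> S\<close>] *(1,3,5)
    have "(u \<otimes> v \<otimes> t) \<otimes> (a \<otimes> w) = (v \<otimes> w) \<otimes> (u \<otimes> (a \<otimes> t))"
      using c by algebra
    also have "\<dots> = (v \<otimes> w) \<otimes> (u \<otimes> (b \<otimes> s))"
      by (simp only: *)
    also have "\<dots> = (u \<otimes> s) \<otimes> (v \<otimes> (b \<otimes> w))"
      using c by algebra
    also have "\<dots> = (u \<otimes> s) \<otimes> (v \<otimes> (c \<otimes> t))"
      by (simp only: *)
    also have "\<dots> = (u \<otimes> v \<otimes> t) \<otimes> (c \<otimes> s)"
      using c by algebra
    finally show "((a, s), (c, w)) \<in> frac_rel R S"
      using * by (auto simp: frac_rel_def intro!: bexI[of _ "u \<otimes> v \<otimes> t"])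
  qed
qed

lemma frac_eq_iff:
  assumes "a \<in> carrier R" "s \<in> S" "b \<in> carrier R" "t \<in> S"
  shows "fraction R S a s = fraction R S b t \<longleftrightarrow> (\<exists>u\<in>S. u \<otimes> (a \<otimes> t) = u \<otimes> (b \<otimes> s))"
  unfolding fraction_def using assms
  by (subst eq_equiv_class_iff[OF equiv_frac_rel]) (auto simp: frac_rel_def)

lemma frac_eqI:
  assumes "a \<in> carrier R" "s \<in> S" "b \<in> carrier R" "t \<in> S" "a \<otimes> t = b \<otimes> s"
  shows "fraction R S a s = fraction R S b t"
  using assms by (subst frac_eq_iff) (auto intro: bexI[of _ \<one>])

lemma carrier_frac_ring: "carrier (frac_ring R S) = {fraction R S a s | a s. a \<in> carrier R \<and> s \<in> S}"
  by (auto simp: frac_ring_def quotient_def fraction_def)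

lemma frac_closed: "a \<in> carrier R \<Longrightarrow> s \<in> S \<Longrightarrow> fraction R S a s \<in> carrier (frac_ring R S)"
  by (auto simp: carrier_frac_ring)

lemma mult_frac:
  assumes "a \<in> carrier R" "s \<in> S" "b \<in> carrier R" "t \<in> S"
  shows "fraction R S a s \<otimes>\<^bsub>frac_ring R S\<^esub> fraction R S b t = fraction R S (a \<otimes> b) (s \<otimes> t)"
proof -
  have "congruent2 (frac_rel R S) (frac_rel R S) (\<lambda>(a, s) (b, t). fraction R S (a \<otimes> b) (s \<otimes> t))"
  proof (rule congruent2I', clarify)
    fix a s a' s' b t b' t'
    assume "((a, s), (a', s')) \<in> frac_rel R S" "((b, t), (b', t')) \<in> frac_rel R S"
    then obtain u v where *: "a \<in> carrier R" "s \<in> S" "a' \<in> carrier R" "s' \<in> S"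
      "b \<in> carrier R" "t \<in> S" "b' \<in> carrier R" "t' \<in> S" "u \<in> S" "v \<in> S"
      "u \<otimes> (a \<otimes> s') = u \<otimes> (a' \<otimes> s)" "v \<otimes> (b \<otimes> t') = v \<otimes> (b' \<otimes> t)"
      by (auto simp: frac_rel_def)
    note c = *(1,3,5,7) *(2,4,6,8-10)[THEN S_simps(1)]
    have "(u \<otimes> v) \<otimes> ((a \<otimes> b) \<otimes> (s' \<otimes> t')) = (u \<otimes> (a \<otimes> s')) \<otimes> (v \<otimes> (b \<otimes> t'))"
      using c by algebra
    also have "\<dots> = (u \<otimes> (a' \<otimes> s)) \<otimes> (v \<otimes> (b' \<otimes> t))"
      by (simp only: *)
    also have "\<dots> = (u \<otimes> v) \<otimes> ((a' \<otimes> b') \<otimes> (s \<otimes> t))"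
      using c by algebra
    finally show "fraction R S (a \<otimes> b) (s \<otimes> t) = fraction R S (a' \<otimes> b') (s' \<otimes> t')"
      using * by (subst frac_eq_iff) (auto intro!: bexI[of _ "u \<otimes> v"])
  qed
  from UN_equiv_class2[OF equiv_frac_rel equiv_frac_rel this, of "(a, s)" "(b, t)"] assms
  show ?thesis by (auto simp: frac_ring_def fraction_def split_def)
qed

lemma add_frac:
  assumes "a \<in> carrier R" "s \<in> S" "b \<in> carrier R" "t \<in> S"
  shows "fraction R S a s \<oplus>\<^bsub>frac_ring R S\<^esub> fraction R S b t = fraction R S (a \<otimes> t \<oplus> b \<otimes> s) (s \<otimes> t)"
proof -
  have "congruent2 (frac_rel R S) (frac_rel R S)
      (\<lambda>(a, s) (b, t). fraction R S (a \<otimes> t \<oplus> b \<otimes> s) (s \<otimes> t))"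
  proof (rule congruent2I', clarify)
    fix a s a' s' b t b' t'
    assume "((a, s), (a', s')) \<in> frac_rel R S" "((b, t), (b', t')) \<in> frac_rel R S"
    then obtain u v where *: "a \<in> carrier R" "s \<in> S" "a' \<in> carrier R" "s' \<in> S"
      "b \<in> carrier R" "t \<in> S" "b' \<in> carrier R" "t' \<in> S" "u \<in> S" "v \<in> S"
      "u \<otimes> (a \<otimes> s') = u \<otimes> (a' \<otimes> s)" "v \<otimes> (b \<otimes> t') = v \<otimes> (b' \<otimes> t)"
      by (auto simp: frac_rel_def)
    note c = *(1,3,5,7) *(2,4,6,8-10)[THEN S_simps(1)]
    have "(u \<otimes> v) \<otimes> ((a \<otimes> t \<oplus> b \<otimes> s) \<otimes> (s' \<otimes> t'))
        = (u \<otimes> (a \<otimes> s')) \<otimes> (v \<otimes> t \<otimes> t') \<oplus> (v \<otimes> (b \<otimes> t')) \<otimes> (u \<otimes> s \<otimes> s')"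
      using c by algebra
    also have "\<dots> = (u \<otimes> (a' \<otimes> s)) \<otimes> (v \<otimes> t \<otimes> t') \<oplus> (v \<otimes> (b' \<otimes> t)) \<otimes> (u \<otimes> s \<otimes> s')"
      by (simp only: *)
    also have "\<dots> = (u \<otimes> v) \<otimes> ((a' \<otimes> t' \<oplus> b' \<otimes> s') \<otimes> (s \<otimes> t))"
      using c by algebra
    finally show "fraction R S (a \<otimes> t \<oplus> b \<otimes> s) (s \<otimes> t) = fraction R S (a' \<otimes> t' \<oplus> b' \<otimes> s') (s' \<otimes> t')"
      using * by (subst frac_eq_iff) (auto intro!: bexI[of _ "u \<otimes> v"])
  qed
  from UN_equiv_class2[OF equiv_frac_rel equiv_frac_rel this, of "(a, s)" "(b, t)"] assms
  show ?thesis by (auto simp: frac_ring_def fraction_def split_def)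
qed

lemma one_frac_ring: "\<one>\<^bsub>frac_ring R S\<^esub> = fraction R S \<one> \<one>"
  and zero_frac_ring: "\<zero>\<^bsub>frac_ring R S\<^esub> = fraction R S \<zero> \<one>"
  by (simp_all add: frac_ring_def)

lemmas frac_ring_simps = mult_frac add_frac one_frac_ring zero_frac_ring frac_closed

lemma frac_ring_is_cring: "cring (frac_ring R S)"
proof (rule cringI)
  show "abelian_group (frac_ring R S)"
  proof (rule abelian_groupI)
    fix x assume "x \<in> carrier (frac_ring R S)"
    then obtain a s where x: "x = fraction R S a s" and c: "a \<in> carrier R" "s \<in> S"
      by (auto simp: carrier_frac_ring)
    note c' = c S_simps(1)[OF c(2)]
    have "fraction R S (\<ominus> a) s \<oplus>\<^bsub>frac_ring R S\<^esub> x = \<zero>\<^bsub>frac_ring R S\<^esub>"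
      unfolding x using c' by (simp add: frac_ring_simps l_minus l_neg) (rule frac_eqI; simp)
    then show "\<exists>y\<in>carrier (frac_ring R S). y \<oplus>\<^bsub>frac_ring R S\<^esub> x = \<zero>\<^bsub>frac_ring R S\<^esub>"
      using c by (intro bexI[of _ "fraction R S (\<ominus> a) s"]) (auto simp: frac_closed)
    show "\<zero>\<^bsub>frac_ring R S\<^esub> \<oplus>\<^bsub>frac_ring R S\<^esub> x = x"
      unfolding x using c' by (simp add: frac_ring_simps)
    fix y assume "y \<in> carrier (frac_ring R S)"
    then obtain b t where y: "y = fraction R S b t" and d: "b \<in> carrier R" "t \<in> S"
      by (auto simp: carrier_frac_ring)
    note d' = d S_simps(1)[OF d(2)]
    show "x \<oplus>\<^bsub>frac_ring R S\<^esub> y \<in> carrier (frac_ring R S)"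
      unfolding x y using c' d' by (simp add: frac_ring_simps)
    show "x \<oplus>\<^bsub>frac_ring R S\<^esub> y = y \<oplus>\<^bsub>frac_ring R S\<^esub> x"
      unfolding x y using c' d' by (simp add: frac_ring_simps a_comm m_comm)
    fix z assume "z \<in> carrier (frac_ring R S)"
    then obtain e w where z: "z = fraction R S e w" and e: "e \<in> carrier R" "w \<in> S"
      by (auto simp: carrier_frac_ring)
    note e' = e S_simps(1)[OF e(2)]
    show "(x \<oplus>\<^bsub>frac_ring R S\<^esub> y) \<oplus>\<^bsub>frac_ring R S\<^esub> z = x \<oplus>\<^bsub>frac_ring R S\<^esub> (y \<oplus>\<^bsub>frac_ring R S\<^esub> z)"
      unfolding x y z using c' d' e' by (simp add: frac_ring_simps l_distr r_distr m_ac a_ac)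
  qed (simp add: frac_ring_simps)
next
  show "comm_monoid (frac_ring R S)"
  proof (rule comm_monoidI)
    fix x assume "x \<in> carrier (frac_ring R S)"
    then obtain a s where x: "x = fraction R S a s" and c: "a \<in> carrier R" "s \<in> S"
      by (auto simp: carrier_frac_ring)
    note c' = c S_simps(1)[OF c(2)]
    show "\<one>\<^bsub>frac_ring R S\<^esub> \<otimes>\<^bsub>frac_ring R S\<^esub> x = x"
      unfolding x using c' by (simp add: frac_ring_simps)
    fix y assume "y \<in> carrier (frac_ring R S)"
    then obtain b t where y: "y = fraction R S b t" and d: "b \<in> carrier R" "t \<in> S"
      by (auto simp: carrier_frac_ring)
    note d' = d S_simps(1)[OF d(2)]
    show "x \<otimes>\<^bsub>frac_ring R S\<^esub> y \<in> carrier (frac_ring R S)"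
      unfolding x y using c' d' by (simp add: frac_ring_simps)
    show "x \<otimes>\<^bsub>frac_ring R S\<^esub> y = y \<otimes>\<^bsub>frac_ring R S\<^esub> x"
      unfolding x y using c' d' by (simp add: frac_ring_simps m_comm)
    fix z assume "z \<in> carrier (frac_ring R S)"
    then obtain e w where z: "z = fraction R S e w" and e: "e \<in> carrier R" "w \<in> S"
      by (auto simp: carrier_frac_ring)
    note e' = e S_simps(1)[OF e(2)]
    show "(x \<otimes>\<^bsub>frac_ring R S\<^esub> y) \<otimes>\<^bsub>frac_ring R S\<^esub> z = x \<otimes>\<^bsub>frac_ring R S\<^esub> (y \<otimes>\<^bsub>frac_ring R S\<^esub> z)"
      unfolding x y z using c' d' e' by (simp add: frac_ring_simps m_assoc)
  qed (simp add: frac_ring_simps)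
next
  fix x y z
  assume "x \<in> carrier (frac_ring R S)" "y \<in> carrier (frac_ring R S)" "z \<in> carrier (frac_ring R S)"
  then obtain a s b t e w where x: "x = fraction R S a s" "y = fraction R S b t" "z = fraction R S e w"
    and c: "a \<in> carrier R" "b \<in> carrier R" "e \<in> carrier R" "s \<in> S" "t \<in> S" "w \<in> S"
    by (auto simp: carrier_frac_ring)
  note c' = c c(4-6)[THEN S_simps(1)]
  show "(x \<oplus>\<^bsub>frac_ring R S\<^esub> y) \<otimes>\<^bsub>frac_ring R S\<^esub> z
      = x \<otimes>\<^bsub>frac_ring R S\<^esub> z \<oplus>\<^bsub>frac_ring R S\<^esub> y \<otimes>\<^bsub>frac_ring R S\<^esub> z"
    unfolding x using c'
    by (simp add: frac_ring_simps) (rule frac_eqI; simp add: l_distr r_distr m_ac a_ac)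
qed

end

lemma localization_is_cring:
  assumes "primeideal q R"
  shows "cring (localization R q)"
proof -
  interpret q: primeideal q R by fact
  have "submonoid (carrier R - q) R"
    by (rule submonoid.intro) (use q.I_prime q.I_notcarr q.one_imp_carrier in auto)
  then show ?thesis
    unfolding localization_def by (rule frac_ring_is_cring)
qed

lemma to_localization_hom:
  assumes "primeideal q R"
  shows "to_localization R q \<in> ring_hom R (localization R q)"
proof -
  interpret q: primeideal q R by fact
  have S: "submonoid (carrier R - q) R"
    by (rule submonoid.intro) (use q.I_prime q.I_notcarr q.one_imp_carrier in auto)
  have "\<one> \<in> carrier R - q"
    by (rule submonoid.one_closed[OF S])
  then show ?thesis
    by (intro ring_hom_memI) (simp_all add: localization_def to_localization_def frac_ring_simps[OF S])
qed

end

end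

theory Submission
  imports Defs
begin

text \<open>
  Since \<open>R/p\<close> has only \<open>p\<close> as an associated prime, \<open>p\<^sup>(\<^sup>n\<^sup>)\<close> consists of the \<open>r\<close> with \<open>s r \<in> p\<^sup>n\<close> for
  some \<open>s \<notin> p\<close>. Let \<open>r\<close> be a nonzero homogeneous element of \<open>p\<^sup>(\<^sup>n\<^sup>)\<close> of degree \<open>\<alpha>(p\<^sup>(\<^sup>n\<^sup>))\<close>. The homogeneous
  ideal \<open>(p\<^sup>n : r)\<close> contains \<open>p\<^sup>n\<close> and some \<open>s \<notin> p\<close>, so, as \<open>dim R/p = 1\<close>, no homogeneous prime other
  than \<open>m\<close> contains it, and hence it contains a power of \<open>m\<close>; that is, the class of \<open>r\<close> lies in
  \<open>H\<^sup>0\<^sub>m(R/p\<^sup>n)\<close>. If \<open>b\<close> is admissible in the definition of \<open>d(p)\<close> and \<open>x\<close> is a nonzero linear form,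
  then \<open>x\<^sup>b\<^sup>n r\<close> is a nonzero element of \<open>p\<^sup>n\<close> for large \<open>n\<close>, so its degree \<open>b n + \<alpha>(p\<^sup>(\<^sup>n\<^sup>))\<close> is at least
  \<open>n \<alpha>(p)\<close>. Dividing by \<open>n\<close> gives the bound; the limit exists by Fekete's lemma, because
  \<open>n \<mapsto> \<alpha>(p\<^sup>(\<^sup>n\<^sup>))\<close> is subadditive in a domain.
\<close>

section \<open>Ideals, symbolic powers and quotients\<close>

context ring
begin

lemma additive_subgroupI:
  assumes "H \<subseteq> carrier R" "\<zero> \<in> H" "\<And>x y. x \<in> H \<Longrightarrow> y \<in> H \<Longrightarrow> x \<oplus> y \<in> H"
    "\<And>x. x \<in> H \<Longrightarrow> \<ominus> x \<in> H"
  shows "additive_subgroup H R"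
  by (rule additive_subgroup.intro, rule add.subgroupI) (use assms in \<open>auto simp: a_inv_def\<close>)

lemma finsum_in_additive_subgroup:
  assumes "additive_subgroup H R" "\<And>i. i \<in> A \<Longrightarrow> f i \<in> H"
  shows "(\<Oplus>i\<in>A. f i) \<in> H"
proof -
  interpret H: additive_subgroup H R by fact
  from assms(2) show ?thesis
  proof (induction A rule: infinite_finite_induct)
    case (insert x F)
    then have "f \<in> F \<rightarrow> carrier R" "f x \<in> carrier R"
      using H.a_subset by auto
    with insert show ?case by simp
  qed auto
qed

end

section \<open>Colon ideals and powers of ideals\<close>

definition colon_ideal :: "('a, 'b) ring_scheme \<Rightarrow> 'a set \<Rightarrow> 'a \<Rightarrow> 'a set" where
  "colon_ideal R I a = {x \<in> carrier R. a \<otimes>\<^bsub>R\<^esub> x \<in> I}"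

context cring
begin

lemma idealI_left:
  assumes "additive_subgroup I R" "\<And>a x. a \<in> I \<Longrightarrow> x \<in> carrier R \<Longrightarrow> x \<otimes> a \<in> I"
  shows "ideal I R"
proof (rule idealI[OF ring_axioms])
  show "subgroup I (add_monoid R)" by (rule additive_subgroup.a_subgroup) fact
  show "a \<otimes> x \<in> I" if "a \<in> I" "x \<in> carrier R" for a x
    using assms that m_comm[of a x] additive_subgroup.a_Hcarr[OF assms(1)] by simp
qed (rule assms)

lemma colon_ideal_ideal: "ideal I R \<Longrightarrow> a \<in> carrier R \<Longrightarrow> ideal (colon_ideal R I a) R"
  unfolding colon_ideal_def by (rule ideal.helper_max_prime) (auto simp: is_cring)

lemma subset_colon_ideal: "ideal I R \<Longrightarrow> a \<in> carrier R \<Longrightarrow> I \<subseteq> colon_ideal R I a"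
  by (auto simp: colon_ideal_def ideal.Icarr ideal.I_l_closed)

text \<open>The elements that \<open>b\<close> multiplies into \<open>I\<close> form the ideal
  \<open>(I : b)\<close>, so containing the generators means containing \<open>Idl A\<close>. This
  passage through a colon ideal recurs below.\<close>

lemma genideal_mult_memI:
  assumes "A \<subseteq> carrier R" "ideal I R" "b \<in> carrier R" "\<And>a. a \<in> A \<Longrightarrow> a \<otimes> b \<in> I" "x \<in> Idl A"
  shows "x \<otimes> b \<in> I"
proof -
  have "Idl A \<subseteq> colon_ideal R I b"
    using assms by (intro genideal_minimal colon_ideal_ideal) (auto simp: colon_ideal_def m_comm)
  with assms(3,5) show ?thesis by (auto simp: colon_ideal_def m_comm)
qed

lemma ideal_ideal_power: "ideal I R \<Longrightarrow> ideal (ideal_power R I n) R"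
  by (induction n) (auto simp: oneideal ideal_prod_is_ideal)

lemma ideal_prod_subsetI:
  assumes "ideal L R" "\<And>i j. i \<in> I \<Longrightarrow> j \<in> J \<Longrightarrow> i \<otimes> j \<in> L"
  shows "ideal_prod R I J \<subseteq> L"
proof
  interpret ideal L R by fact
  fix x assume "x \<in> ideal_prod R I J"
  then show "x \<in> L" by induction (use assms in auto)
qed

lemma ideal_power_mult:
  assumes "ideal I R" "a \<in> ideal_power R I m" "b \<in> ideal_power R I n"
  shows "a \<otimes> b \<in> ideal_power R I (m + n)"
  using assms(2)
proof (induction m arbitrary: a)
  case 0
  interpret ideal "ideal_power R I n" R by (rule ideal_ideal_power) fact
  from 0 assms(3) show ?case by (simp add: I_l_closed)
next
  case (Suc m)
  interpret I: ideal I R by fact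
  interpret Im: ideal "ideal_power R I m" R by (rule ideal_ideal_power) fact
  have b: "b \<in> carrier R"
    using ideal.Icarr[OF ideal_ideal_power[OF assms(1)] assms(3)] .
  let ?L = "ideal_power R I (Suc m + n)"
  interpret L: ideal ?L R by (rule ideal_ideal_power) fact
  \<comment> \<open>With the ideal \<open>(L : b)\<close> as target, sums in the product ideal need
    no separate treatment and single products \<open>i j\<close> remain.\<close>
  have "ideal_prod R I (ideal_power R I m) \<subseteq> colon_ideal R ?L b"
  proof (rule ideal_prod_subsetI[OF colon_ideal_ideal[OF L.is_ideal b]])
    fix i j assume ij: "i \<in> I" "j \<in> ideal_power R I m"
    have "i \<otimes> (j \<otimes> b) \<in> ?L"
      using Suc.IH[OF ij(2)] ij(1) by (auto intro: ideal_prod.prod)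
    moreover have "i \<otimes> (j \<otimes> b) = b \<otimes> (i \<otimes> j)"
      using ij b by (simp add: m_ac)
    ultimately show "i \<otimes> j \<in> colon_ideal R ?L b"
      using ij by (simp add: colon_ideal_def)
  qed
  with Suc.prems have "b \<otimes> a \<in> ?L" "a \<in> carrier R" by (auto simp: colon_ideal_def)
  with b show ?case by (simp add: m_comm)
qed

lemma pow_in_ideal_power: "ideal I R \<Longrightarrow> a \<in> I \<Longrightarrow> a [^] n \<in> ideal_power R I n"
proof (induction n)
  case (Suc n)
  have "a \<in> carrier R" using Suc by (auto simp: ideal.Icarr)
  moreover have "a \<otimes> a [^] n \<in> ideal_prod R I (ideal_power R I n)"
    using Suc by (intro ideal_prod.prod)
  ultimately show ?case by (simp only: nat_pow_Suc2 ideal_power.simps)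
qed simp

lemma ideal_power_subset_prime:
  assumes "primeideal P R" "ideal I R" "ideal_power R I n \<subseteq> P"
  shows "I \<subseteq> P"
proof
  interpret primeideal P R by fact
  fix a assume "a \<in> I"
  then have a: "a \<in> carrier R" "a [^] n \<in> P"
    using assms by (auto simp: ideal.Icarr dest: pow_in_ideal_power)
  then show "a \<in> P"
  proof (induction n)
    case 0
    then show ?case using one_imp_carrier I_notcarr by auto
  next
    case (Suc n)
    then show ?case using I_prime[of "a [^] n" a] by auto
  qed
qed

text \<open>Induction on the sum of the exponents: replacing \<open>I\<close> by \<open>(I : x)\<close> lowers the exponent of \<open>x\<close>.\<close>

lemma ideal_power_genideal_subset:
  assumes "finite X" "X \<subseteq> carrier R" "ideal I R" "\<And>x. x \<in> X \<Longrightarrow> x [^] N x \<in> I" "(\<Sum>x\<in>X. N x) = s"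
  shows "ideal_power R (Idl X) (Suc s) \<subseteq> I"
  using assms(3-5)
proof (induction s arbitrary: I N rule: less_induct)
  case (less s)
  interpret ideal I R by (rule less)
  let ?J = "ideal_power R (Idl X) s"
  interpret J: ideal ?J R
    by (intro ideal_ideal_power genideal_ideal assms)
  show ?case
  proof (cases "\<exists>x\<in>X. N x = 0")
    \<comment> \<open>A zero exponent puts \<open>\<one>\<close> into \<open>I\<close>. Afterwards
      all exponents are positive and can be lowered.\<close>
    case True
    then have "\<one> \<in> I" using less.prems(2) by fastforce
    then have "I = carrier R" by (rule one_imp_carrier)
    then show ?thesis
      using ideal_ideal_power[OF genideal_ideal[OF assms(2)]] by (metis ideal.Icarr subsetI)
  next
    case False
    have *: "x \<otimes> j \<in> I" if x: "x \<in> X" and j: "j \<in> ?J" for x j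
    proof -
      have xc: "x \<in> carrier R" using x assms by auto
      have Nx: "N x > 0" using False x by auto
      define N' where "N' = N(x := N x - 1)"
      have "sum N' (X - {x}) = sum N (X - {x})"
        by (rule sum.cong) (auto simp: N'_def)
      then have "(\<Sum>x\<in>X. N' x) = s - 1"
        using x \<open>finite X\<close> Nx less.prems(3) by (simp add: N'_def sum.remove[of X x])
      \<comment> \<open>Positivity makes \<open>Suc (s - 1) = s\<close> despite truncated
        subtraction, and makes \<open>s - 1\<close> a smaller instance for the induction.\<close>
      moreover have s: "s > 0"
        using x \<open>finite X\<close> Nx less.prems(3) by (metis False gr0I sum_eq_0_iff)
      moreover have "y [^] N' y \<in> colon_ideal R I x" if y: "y \<in> X" for y
      proof -
        have yc: "y \<in> carrier R" using y assms by auto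
        show ?thesis
        proof (cases "y = x")
          case True
          have "x \<otimes> x [^] (N x - 1) = x [^] N x"
            using Nx xc by (metis Suc_pred' nat_pow_Suc2)
          with True y less.prems(2)[OF y] xc show ?thesis
            by (simp add: colon_ideal_def N'_def)
        next
          case False
          with less.prems(2)[OF y] xc yc show ?thesis
            by (simp add: colon_ideal_def N'_def I_l_closed)
        qed
      qed
      ultimately have "ideal_power R (Idl X) (Suc (s - 1)) \<subseteq> colon_ideal R I x"
        by (intro less.IH[of "s - 1" _ N'] colon_ideal_ideal xc is_ideal) auto
      with s j show ?thesis by (auto simp: colon_ideal_def)
    qed
    show ?thesis
      unfolding ideal_power.simps
    proof (rule ideal_prod_subsetI[OF is_ideal])
      fix i j assume "i \<in> Idl X" "j \<in> ?J"
      then show "i \<otimes> j \<in> I"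
        by (intro genideal_mult_memI[OF assms(2) is_ideal, of j i] * J.Icarr)
    qed
  qed
qed

section \<open>Localization at a prime, associated primes and symbolic powers\<close>

text \<open>The fractions with numerator in \<open>J\<close> already form an ideal, so the extension
  of \<open>J\<close> consists of such fractions. Clearing denominators in \<open>r/1 = a/s\<close>
  yields a multiplier outside \<open>q\<close>.\<close>

lemma extend_contract_prime:
  assumes "primeideal q R" "ideal J R"
  shows "extend_contract R q J = {r \<in> carrier R. \<exists>s\<in>carrier R - q. s \<otimes> r \<in> J}"
proof -
  interpret q: primeideal q R by fact
  interpret J: ideal J R by fact
  let ?S = "carrier R - q"
  have S: "submonoid ?S R"
    by (rule submonoid.intro) (use q.I_prime q.I_notcarr q.one_imp_carrier in auto)
  note simps = frac_ring_simps[OF S] 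
  have S_mult: "s \<otimes> t \<in> ?S" if "s \<in> ?S" "t \<in> ?S" for s t
    using submonoid.m_closed[OF S that] .
  have one: "\<one> \<in> ?S" by (rule submonoid.one_closed[OF S])
  let ?L = "frac_ring R ?S"
  interpret L: cring ?L by (rule frac_ring_is_cring[OF S])
  have gens: "to_localization R q ` J \<subseteq> carrier ?L"
    using one by (auto simp: to_localization_def simps)
  let ?E = "{fraction R ?S a s | a s. a \<in> J \<and> s \<in> ?S}"
  have minus: "\<ominus>\<^bsub>?L\<^esub> fraction R ?S a s = fraction R ?S (\<ominus> a) s" if "a \<in> carrier R" "s \<in> ?S" for a s
  proof (rule L.minus_equality)
    show "fraction R ?S (\<ominus> a) s \<oplus>\<^bsub>?L\<^esub> fraction R ?S a s = \<zero>\<^bsub>?L\<^esub>"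
      using that S_mult one by (simp add: simps l_minus l_neg) (rule frac_eqI[OF S]; simp)
  qed (use that in \<open>auto simp: simps\<close>)
  \<comment> \<open>Common denominators give closure under addition. By minimality the extended
    ideal is then contained in \<open>?E\<close>.\<close>
  have E: "ideal ?E ?L"
  proof (rule L.idealI_left[OF L.additive_subgroupI], goal_cases)
    case 1
    then show ?case by (auto simp: simps)
  next
    case 2
    have "\<zero> \<in> J" by simp
    with one show ?case by (simp only: simps) blast
  next
    case (3 x y)
    then obtain a s b t where x: "x = fraction R ?S a s" "a \<in> J" "s \<in> ?S"
      and y: "y = fraction R ?S b t" "b \<in> J" "t \<in> ?S" by blast
    have "x \<oplus>\<^bsub>?L\<^esub> y = fraction R ?S (a \<otimes> t \<oplus> b \<otimes> s) (s \<otimes> t)"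
      using x y by (auto simp: simps)
    moreover have "a \<otimes> t \<oplus> b \<otimes> s \<in> J"
      using x y by (auto simp: J.I_r_closed)
    ultimately show ?case using S_mult[OF x(3) y(3)] by blast
  next
    case (4 x)
    then show ?case using J.a_inv_closed by (auto simp: minus) blast
  next
    case (5 x y)
    then obtain a s b t where x: "x = fraction R ?S a s" "a \<in> J" "s \<in> ?S"
      and y: "y = fraction R ?S b t" "b \<in> carrier R" "t \<in> ?S" 
      by (auto simp: carrier_frac_ring[OF S])
    have "y \<otimes>\<^bsub>?L\<^esub> x = fraction R ?S (b \<otimes> a) (t \<otimes> s)"
      using x y by (auto simp: simps)
    moreover have "b \<otimes> a \<in> J"
      using x y by (auto simp: J.I_l_closed)
    ultimately show ?case using S_mult[OF y(3) x(3)] by blast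
  qed
  have "(to_localization R q r \<in> genideal ?L (to_localization R q ` J)) \<longleftrightarrow>
      (\<exists>s\<in>?S. s \<otimes> r \<in> J)" if r: "r \<in> carrier R" for r
  proof
    assume "to_localization R q r \<in> genideal ?L (to_localization R q ` J)"
    moreover have "genideal ?L (to_localization R q ` J) \<subseteq> ?E"
      by (rule L.genideal_minimal[OF E]) (use one in \<open>auto simp: to_localization_def\<close>)
    ultimately obtain a s where as: "fraction R ?S r \<one> = fraction R ?S a s" "a \<in> J" "s \<in> ?S"
      by (auto simp: to_localization_def)
    then obtain u where u: "u \<in> ?S" "u \<otimes> (r \<otimes> s) = u \<otimes> (a \<otimes> \<one>)"
      using r one by (auto simp: frac_eq_iff[OF S])
    \<comment> \<open>The multiplier is \<open>u s\<close>: \<open>u\<close> comes from the equality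
      of fractions, \<open>s\<close> from the denominator, and both avoid the prime
      \<open>q\<close>.\<close>
    have "(u \<otimes> s) \<otimes> r = u \<otimes> (a \<otimes> \<one>)"
      unfolding u(2)[symmetric] using u(1) as r by (simp add: m_ac)
    then have "(u \<otimes> s) \<otimes> r \<in> J"
      using u as by (simp add: J.I_l_closed)
    then show "\<exists>s\<in>?S. s \<otimes> r \<in> J"
      using S_mult[OF u(1) as(3)] by blast
  next
    assume "\<exists>s\<in>?S. s \<otimes> r \<in> J"
    then obtain s where s: "s \<in> ?S" "s \<otimes> r \<in> J" by blast
    have sc: "s \<in> carrier R" using s by simp
    have "to_localization R q r = fraction R ?S \<one> s \<otimes>\<^bsub>?L\<^esub> to_localization R q (s \<otimes> r)"
      using s(1) sc r one unfolding to_localization_def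
      by (simp add: simps) (rule frac_eqI[OF S]; simp add: m_ac)
    also have "\<dots> \<in> genideal ?L (to_localization R q ` J)"
      using s one L.genideal_self[OF gens]
      by (intro ideal.I_l_closed[OF L.genideal_ideal[OF gens]]) (auto simp: simps)
    finally show "to_localization R q r \<in> genideal ?L (to_localization R q ` J)" .
  qed
  then show ?thesis
    unfolding extend_contract_def localization_def by blast
qed

lemma carrier_quotient: "ideal I R \<Longrightarrow> carrier (R Quot I) = {I +> r | r. r \<in> carrier R}"
  by (auto simp: FactRing_simps)

lemma coset_eq_ideal_iff:
  assumes "ideal I R" "a \<in> carrier R"
  shows "I +> a = I \<longleftrightarrow> a \<in> I"
  using a_rcos_zero[OF assms(1)] ideal.rcos_const_imp_mem[OF assms] by iprover

lemma quotient_module_smult_eq_zero_iff: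
  assumes "ideal I R" "r \<in> carrier R" "y \<in> carrier R"
  shows "r \<odot>\<^bsub>quotient_module R I\<^esub> (I +> y) = \<zero>\<^bsub>quotient_module R I\<^esub> \<longleftrightarrow> r \<otimes> y \<in> I"
  using assms by (simp add: FactRing_def ideal.rcoset_mult_add coset_eq_ideal_iff)

text \<open>By primality every nonzero class in \<open>R/q\<close> has annihilator exactly
  \<open>q\<close>. The zero class has annihilator \<open>R\<close>, which is not a prime
  ideal.\<close>

lemma associated_primes_quotient_prime:
  assumes "primeideal q R"
  shows "associated_primes R (quotient_module R q) = {q}"
proof -
  interpret q: primeideal q R by fact
  have ann: "{r \<in> carrier R. r \<odot>\<^bsub>quotient_module R q\<^esub> (q +> y) = \<zero>\<^bsub>quotient_module R q\<^esub>} =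
    (if y \<in> q then carrier R else q)" if "y \<in> carrier R" for y
  proof -
    have "{r \<in> carrier R. r \<odot>\<^bsub>quotient_module R q\<^esub> (q +> y) = \<zero>\<^bsub>quotient_module R q\<^esub>} =
      {r \<in> carrier R. r \<otimes> y \<in> q}"
      using that q.is_ideal by (simp only: quotient_module_smult_eq_zero_iff cong: conj_cong)
    also have "\<dots> = (if y \<in> q then carrier R else q)"
      using that q.I_prime q.I_l_closed q.I_r_closed by auto
    finally show ?thesis .
  qed
  show ?thesis
  proof (intro equalityI subsetI)
    fix P assume "P \<in> associated_primes R (quotient_module R q)"
    then obtain x where P: "primeideal P R" and x: "x \<in> carrier (R Quot q)"
      "P = {r \<in> carrier R. r \<odot>\<^bsub>quotient_module R q\<^esub> x = \<zero>\<^bsub>quotient_module R q\<^esub>}"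
      by (auto simp: associated_primes_def simp del: quotient_module_simps(6))
    then obtain y where y: "y \<in> carrier R" "x = q +> y"
      by (auto simp: carrier_quotient[OF q.is_ideal])
    show "P \<in> {q}"
      using x(2) primeideal.I_notcarr[OF P] unfolding y(2) ann[OF y(1)] by (auto split: if_splits)
  next
    fix P assume "P \<in> {q}"
    moreover have "\<one> \<notin> q" using q.one_imp_carrier q.I_notcarr by auto
    moreover have "q +> \<one> \<in> carrier (R Quot q)"
      by (auto simp: carrier_quotient[OF q.is_ideal])
    ultimately show "P \<in> associated_primes R (quotient_module R q)"
      using ann[of \<one>] q.primeideal unfolding associated_primes_def
      by (auto simp del: quotient_module_simps(6) intro!: bexI[of _ "q +> \<one>"])
  qed
qed

lemma symbolic_power_prime:
  assumes "primeideal q R"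
  shows "symbolic_power R q n = {r \<in> carrier R. \<exists>s\<in>carrier R - q. s \<otimes> r \<in> ideal_power R q n}"
proof -
  interpret q: primeideal q R by fact
  show ?thesis
    using assms
    by (auto simp: symbolic_power_def associated_primes_quotient_prime
        extend_contract_prime[OF _ ideal_ideal_power[OF q.is_ideal]])
qed

lemma ideal_power_subset_symbolic_power:
  assumes "primeideal q R"
  shows "ideal_power R q n \<subseteq> symbolic_power R q n"
proof
  interpret q: primeideal q R by fact
  have "\<one> \<in> carrier R - q" using q.one_imp_carrier q.I_notcarr by auto
  moreover fix r assume "r \<in> ideal_power R q n"
  moreover from this have "r \<in> carrier R"
    using ideal.Icarr[OF ideal_ideal_power[OF q.is_ideal]] by blast
  ultimately show "r \<in> symbolic_power R q n"
    by (auto simp: symbolic_power_prime[OF assms] intro!: bexI[of _ \<one>])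
qed

text \<open>The product of the two multipliers stays outside the prime \<open>q\<close> and carries
  \<open>a b\<close> into the power \<open>m + n\<close>. This is the source of the subadditivity of
  the initial degrees.\<close>

lemma symbolic_power_mult:
  assumes "primeideal q R" "a \<in> symbolic_power R q m" "b \<in> symbolic_power R q n"
  shows "a \<otimes> b \<in> symbolic_power R q (m + n)"
proof -
  interpret q: primeideal q R by fact
  obtain s t where st: "s \<in> carrier R - q" "s \<otimes> a \<in> ideal_power R q m"
    "t \<in> carrier R - q" "t \<otimes> b \<in> ideal_power R q n" and ab: "a \<in> carrier R" "b \<in> carrier R"
    using assms(2,3) by (auto simp: symbolic_power_prime[OF assms(1)])
  have "(s \<otimes> t) \<otimes> (a \<otimes> b) = (s \<otimes> a) \<otimes> (t \<otimes> b)"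
    using st(1,3) ab by (auto simp: m_ac)
  also have "\<dots> \<in> ideal_power R q (m + n)"
    by (intro ideal_power_mult q.is_ideal st)
  finally have "(s \<otimes> t) \<otimes> (a \<otimes> b) \<in> ideal_power R q (m + n)" .
  moreover have "s \<otimes> t \<in> carrier R - q"
    using st q.I_prime by auto
  ultimately show ?thesis
    using ab by (auto simp: symbolic_power_prime[OF assms(1)])
qed

lemma local_cohomology_0_quotientI:
  assumes "ideal I R" "ideal J R" "y \<in> carrier R" "\<And>r. r \<in> ideal_power R J k \<Longrightarrow> r \<otimes> y \<in> I"
  shows "I +> y \<in> local_cohomology_0 R J (quotient_module R I)"
proof -
  have "r \<odot>\<^bsub>quotient_module R I\<^esub> (I +> y) = \<zero>\<^bsub>quotient_module R I\<^esub>"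
    if "r \<in> ideal_power R J k" for r
    using assms that ideal.Icarr[OF ideal_ideal_power[OF assms(2)] that]
    by (subst quotient_module_smult_eq_zero_iff) auto
  moreover have "I +> y \<in> carrier (quotient_module R I)"
    using assms(3) by (auto simp: carrier_quotient[OF assms(1)])
  ultimately show ?thesis
    unfolding local_cohomology_0_def by blast
qed

section \<open>Primes of a quotient ring and its Krull dimension\<close>

text \<open>Because \<open>I \<subseteq> P\<close>, whether a coset lies in the image of
  \<open>P\<close> can be read off any representative, and primality carries over.\<close>

lemma primeideal_quotient:
  assumes "ideal I R" "primeideal P R" "I \<subseteq> P"
  shows "primeideal ((+>) I ` P) (R Quot I)"
proof -
  interpret I: ideal I R by fact
  interpret P: primeideal P R by fact
  interpret Q: cring "R Quot I" by (rule I.quotient_is_cring[OF is_cring])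
  have mem: "I +> a \<in> (+>) I ` P \<longleftrightarrow> a \<in> P" if a: "a \<in> carrier R" for a
  proof
    assume "I +> a \<in> (+>) I ` P"
    then obtain b where b: "b \<in> P" "I +> a = I +> b" by auto
    then have "a \<ominus> b \<in> P"
      using assms a quotient_eq_iff_same_a_r_cos[OF assms(1), of a b] by auto
    then have "(a \<ominus> b) \<oplus> b \<in> P" using b by auto
    moreover have "(a \<ominus> b) \<oplus> b = a" using a b P.Icarr[OF b(1)] by algebra
    ultimately show "a \<in> P" by simp
  qed auto
  show ?thesis
  proof (rule primeidealI[OF ring_ideal_imp_quot_ideal[OF assms(1) P.is_ideal] Q.is_cring])
    have "\<one> \<notin> P" using P.one_imp_carrier P.I_notcarr by auto
    then have "I +> \<one> \<notin> (+>) I ` P" using mem by simp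
    then show "carrier (R Quot I) \<noteq> (+>) I ` P"
      by (auto simp: carrier_quotient[OF assms(1)])
  next
    fix x y assume "x \<in> carrier (R Quot I)" "y \<in> carrier (R Quot I)" "x \<otimes>\<^bsub>R Quot I\<^esub> y \<in> (+>) I ` P"
    moreover from this obtain a b where "x = I +> a" "y = I +> b"
      and ab: "a \<in> carrier R" "b \<in> carrier R"
      by (auto simp: carrier_quotient[OF assms(1)])
    moreover have "(I +> a) \<otimes>\<^bsub>R Quot I\<^esub> (I +> b) = I +> (a \<otimes> b)"
      using ab by (simp add: FactRing_def I.rcoset_mult_add)
    ultimately show "x \<in> (+>) I ` P \<or> y \<in> (+>) I ` P"
      using P.I_prime[OF ab] mem by auto
  qed
qed

text \<open>The ideal correspondence is injective on ideals above \<open>P0\<close>, so the images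
  of the three primes form a strict chain of length 2.\<close>

lemma krull_dim_quotient_ge_2:
  assumes "primeideal P0 R" "primeideal P1 R" "primeideal P2 R" "P0 \<subset> P1" "P1 \<subset> P2"
  shows "krull_dim (R Quot P0) \<ge> 2"
proof -
  interpret P0: primeideal P0 R by fact
  \<comment> \<open>Chains are indexed by all of \<open>nat\<close>; from index 2 on the sequence is
    constant.\<close>
  define P where "P = (\<lambda>i::nat. (+>) P0 ` (if i = 0 then P0 else if i = 1 then P1 else P2))"
  have inj: "inj_on (\<lambda>J. (+>) P0 ` J) {J. ideal J R \<and> P0 \<subseteq> J}"
    by (rule bij_betw_imp_inj_on[OF quot_ideal_correspondence]) (rule P0.is_ideal)
  have "P i \<subset> P (Suc i)" if "i < 2" for i
    using that assms inj_onD[OF inj, of P0 P1] inj_onD[OF inj, of P1 P2]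
    by (auto simp: P_def less_2_cases_iff primeideal.axioms(1) psubset_eq)
  moreover have "primeideal (P i) (R Quot P0)" for i
    unfolding P_def using assms by (intro primeideal_quotient P0.is_ideal) auto
  ultimately have "enat 2 \<le> krull_dim (R Quot P0)"
    unfolding krull_dim_def by (intro Sup_upper CollectI exI[of _ "2::nat"] conjI refl exI[of _ P]) auto
  then show ?thesis by (simp add: numeral_eq_enat)
qed

end

section \<open>Fekete's lemma and the slope \<open>d(I)\<close>\<close>

text \<open>Fekete's lemma: the limit is the infimum of the quotients. Division with remainder by an
  \<open>m\<close> whose quotient is close to the infimum bounds all later quotients.\<close>

lemma subadditive_quotient_convergent:
  fixes u :: "nat \<Rightarrow> real"
  assumes sub: "\<And>m n. u (m + n) \<le> u m + u n" and nonneg: "\<And>n. 0 \<le> u n"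
  shows "convergent (\<lambda>n. u n / real n)"
proof -
  \<comment> \<open>The index starts at 1 because \<open>u 0 / 0\<close> has the default value 0,
    which would spoil the infimum.\<close>
  define L where "L = (INF n\<in>{1..}. u n / real n)"
  have bdd: "bdd_below ((\<lambda>n. u n / real n) ` {1..})"
    by (rule bdd_belowI[of _ 0]) (auto simp: nonneg)
  have lower: "L \<le> u n / real n" if "n \<ge> 1" for n
    unfolding L_def using bdd that by (intro cINF_lower) auto
  have mult: "u (q * m + r) \<le> real q * u m + u r" for q m r
  proof (induction q)
    case (Suc q)
    have "u (Suc q * m + r) \<le> u m + u (q * m + r)"
      using sub[of m "q * m + r"] by (simp add: add.assoc)
    also have "\<dots> \<le> real (Suc q) * u m + u r"
      using Suc by (simp add: algebra_simps)
    finally show ?case .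
  qed simp
  have "(\<lambda>n. u n / real n) \<longlonglongrightarrow> L"
  proof (rule LIMSEQ_I)
    fix e :: real assume e: "e > 0"
    have "(INF n\<in>{1..}. u n / real n) < L + e / 2"
      using e unfolding L_def by simp
    then obtain m where m: "m \<ge> 1" "u m / real m < L + e / 2"
      using bdd by (subst (asm) cINF_less_iff) auto
    \<comment> \<open>A common bound for the contributions of all remainders modulo
      \<open>m\<close>, available since \<open>u\<close> is nonnegative.\<close>
    define C where "C = (\<Sum>r<m. u r)"
    have C: "u r \<le> C" if "r < m" for r
      unfolding C_def using that by (intro member_le_sum) (auto simp: nonneg)
    \<comment> \<open>Beyond \<open>N\<close> the remainder term \<open>C / n\<close> is below
      \<open>e / 2\<close>; the maximum with 0 forces \<open>N > 0\<close>.\<close>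
    obtain N where N: "real N > 2 * C / e" "N > 0"
      using reals_Archimedean2[of "max (2 * C / e) 0"] by auto
    have "norm (u n / real n - L) < e" if n: "n \<ge> N" for n
    proof -
      have n0: "n > 0" using n N by simp
      have "u n \<le> real (n div m) * u m + u (n mod m)"
        using mult[of "n div m" m "n mod m"] by simp
      also have "u (n mod m) \<le> C" using C m by simp
      also have "real (n div m) * u m \<le> (real n / real m) * u m"
        by (intro mult_right_mono nonneg) (rule of_nat_div_le_of_nat)
      finally have "u n / real n \<le> (real n / real m * u m + C) / real n"
        using n0 by (simp add: divide_right_mono)
      also have "\<dots> = u m / real m + C / real n"
        using n0 by (simp add: field_simps)
      also have "C / real n < e / 2"
      proof -
        have "2 * C < e * real N" using N(1) e by (simp add: field_simps)
        also have "\<dots> \<le> e * real n" using e n by simp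
        finally show ?thesis using n0 by (simp add: field_simps)
      qed
      finally show ?thesis using m(2) lower[of n] n0 by simp
    qed
    then show "\<exists>N. \<forall>n\<ge>N. norm (u n / real n - L) < e" by blast
  qed
  then show ?thesis by (rule convergentI)
qed

text \<open>A nonempty set of naturals attains its infimum in \<open>enat\<close>, so a finite slope
  is itself admissible; with no admissible \<open>b\<close> the infimum is
  \<open>\<infinity>\<close>.\<close>

lemma sat_slope_cases:
  obtains "sat_slope R gr I = \<infinity>"
  | b where "sat_slope R gr I = enat b"
    "\<forall>\<^sub>F n in sequentially. \<forall>r\<in>ideal_power R (irrelevant_ideal R gr) (b * n).
      \<forall>x\<in>local_cohomology_0 R (irrelevant_ideal R gr) (quotient_module R (ideal_power R I n)).
        r \<odot>\<^bsub>quotient_module R (ideal_power R I n)\<^esub> x = \<zero>\<^bsub>quotient_module R (ideal_power R I n)\<^esub>"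
proof -
  define Q where "Q b \<longleftrightarrow> (\<forall>\<^sub>F n in sequentially. \<forall>r\<in>ideal_power R (irrelevant_ideal R gr) (b * n).
      \<forall>x\<in>local_cohomology_0 R (irrelevant_ideal R gr) (quotient_module R (ideal_power R I n)).
        r \<odot>\<^bsub>quotient_module R (ideal_power R I n)\<^esub> x = \<zero>\<^bsub>quotient_module R (ideal_power R I n)\<^esub>)" for b
  have eq: "sat_slope R gr I = Inf {enat b | b. Q b}"
    by (simp add: sat_slope_def Q_def Let_def del: quotient_module_simps)
  show ?thesis
  proof (cases "\<exists>b. Q b")
    case True
    then have "Inf {enat b | b. Q b} \<in> {enat b | b. Q b}"
      unfolding Inf_enat_def by (auto intro: LeastI2)
    then obtain b where "sat_slope R gr I = enat b" "Q b"
      unfolding eq by blast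
    then show ?thesis by (intro that(2)) (simp_all only: Q_def)
  next
    case False
    then show ?thesis by (intro that(1)) (simp add: eq Inf_enat_def)
  qed
qed

section \<open>Homogeneous components and graded ideals\<close>

context standard_graded_algebra
begin

text \<open>The description is meaningful on the carrier, where the decomposition exists and is
  unique; hence the carrier hypotheses that follow.\<close>

definition component :: "'a \<Rightarrow> nat \<Rightarrow> 'a" where
  "component r = (THE f. (\<forall>n. f n \<in> gr n) \<and> finite {n. f n \<noteq> \<zero>} \<and> r = (\<Oplus>n\<in>{n. f n \<noteq> \<zero>}. f n))"

lemma gr_carrier: "r \<in> gr n \<Longrightarrow> r \<in> carrier R"
  using gr_subgroup additive_subgroup.a_subset by blast

lemma gr_zero [simp]: "\<zero> \<in> gr n"
  using gr_subgroup by (rule additive_subgroup.zero_closed)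

lemma component_spec:
  assumes "r \<in> carrier R"
  shows "(\<forall>n. component r n \<in> gr n) \<and> finite {n. component r n \<noteq> \<zero>} \<and>
    r = (\<Oplus>n\<in>{n. component r n \<noteq> \<zero>}. component r n)"
  unfolding component_def by (rule theI'[OF gr_decomp[OF assms]])

lemma component_gr: "r \<in> carrier R \<Longrightarrow> component r n \<in> gr n"
  using component_spec by blast

lemma component_carrier [simp]: "r \<in> carrier R \<Longrightarrow> component r n \<in> carrier R"
  using component_gr gr_carrier by blast

lemma finite_support_component: "r \<in> carrier R \<Longrightarrow> finite {n. component r n \<noteq> \<zero>}"
  using component_spec by blast

lemma finsum_component:
  assumes "r \<in> carrier R" "finite A" "{n. component r n \<noteq> \<zero>} \<subseteq> A"
  shows "(\<Oplus>n\<in>A. component r n) = r"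
proof -
  have "(\<Oplus>n\<in>A. component r n) = (\<Oplus>n\<in>{n. component r n \<noteq> \<zero>}. component r n)"
    using assms by (intro add.finprod_mono_neutral_cong_right) auto
  then show ?thesis using component_spec[OF assms(1)] by simp
qed

text \<open>Any finite \<open>A\<close> containing the support may be used, so that sums and shifts
  can be treated without computing exact supports.\<close>

lemma component_unique:
  assumes "\<And>n. f n \<in> gr n" "finite A" "\<And>n. n \<notin> A \<Longrightarrow> f n = \<zero>" "(\<Oplus>n\<in>A. f n) = r"
  shows "component r = f"
proof -
  have f: "f n \<in> carrier R" for n using assms(1) gr_carrier by blast
  have supp: "{n. f n \<noteq> \<zero>} \<subseteq> A" using assms(3) by auto
  have "(\<Oplus>n\<in>{n. f n \<noteq> \<zero>}. f n) = (\<Oplus>n\<in>A. f n)"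
    using f supp assms(2) by (intro add.finprod_mono_neutral_cong_left) auto
  moreover have "r \<in> carrier R"
    unfolding assms(4)[symmetric] using f by (intro finsum_closed) auto
  ultimately show ?thesis
    unfolding component_def
    using assms(1,4) supp finite_subset[OF supp assms(2)]
    by (intro the1_equality[OF gr_decomp]) auto
qed

lemma component_add:
  assumes "a \<in> carrier R" "b \<in> carrier R"
  shows "component (a \<oplus> b) n = component a n \<oplus> component b n"
proof -
  let ?A = "{n. component a n \<noteq> \<zero>} \<union> {n. component b n \<noteq> \<zero>}"
  have fin: "finite ?A" using assms by (simp add: finite_support_component)
  have "component (a \<oplus> b) = (\<lambda>n. component a n \<oplus> component b n)"
  proof (rule component_unique[OF _ fin])
    show "component a n \<oplus> component b n \<in> gr n" for n
      by (intro additive_subgroup.a_closed[OF gr_subgroup] component_gr assms)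
    show "component a n \<oplus> component b n = \<zero>" if "n \<notin> ?A" for n
      using that by simp
    have "(\<Oplus>n\<in>?A. component a n \<oplus> component b n) =
        (\<Oplus>n\<in>?A. component a n) \<oplus> (\<Oplus>n\<in>?A. component b n)"
      using assms by (intro finsum_addf) auto
    then show "(\<Oplus>n\<in>?A. component a n \<oplus> component b n) = a \<oplus> b"
      using finsum_component[OF assms(1) fin] finsum_component[OF assms(2) fin] by simp
  qed
  then show ?thesis by simp
qed

lemma component_homogeneous:
  assumes "r \<in> gr m"
  shows "component r n = (if n = m then r else \<zero>)"
proof -
  have "component r = (\<lambda>n. if n = m then r else \<zero>)"
    using assms gr_carrier by (intro component_unique[of _ "{m}"]) auto
  then show ?thesis by simp
qed

lemma component_zero [simp]: "component \<zero> n = \<zero>"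
  using component_homogeneous[of \<zero> n] by simp

lemma component_minus:
  assumes "a \<in> carrier R"
  shows "component (\<ominus> a) n = \<ominus> component a n"
proof -
  have "component (\<ominus> a) n \<oplus> component a n = \<zero>"
    using assms component_add[of "\<ominus> a" a n] by (simp add: l_neg)
  then show ?thesis using assms by (metis a_inv_closed component_carrier minus_equality)
qed

text \<open>Distributing \<open>a\<close> over the decomposition of \<open>b\<close> gives the
  decomposition of \<open>a b\<close>, shifted by \<open>m\<close>. The case \<open>n < m\<close> is
  separate because \<open>n - m\<close> is truncated.\<close>

lemma component_mult_homogeneous:
  assumes "a \<in> gr m" "b \<in> carrier R"
  shows "component (a \<otimes> b) n = (if n < m then \<zero> else a \<otimes> component b (n - m))"
proof -
  have a: "a \<in> carrier R" using assms gr_carrier by blast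
  let ?S = "{n. component b n \<noteq> \<zero>}"
  let ?f = "\<lambda>n. if n < m then \<zero> else a \<otimes> component b (n - m)"
  have fin: "finite ?S" using assms(2) by (rule finite_support_component)
  have "component (a \<otimes> b) = ?f"
  proof (rule component_unique)
    show "?f n \<in> gr n" for n
      using gr_mult[OF assms(1) component_gr[OF assms(2)], of "n - m"] by auto
    show "finite ((+) m ` ?S)" using fin by simp
    show "?f n = \<zero>" if "n \<notin> (+) m ` ?S" for n
    proof (cases "n < m")
      case False
      then have "n = m + (n - m)" by simp
      with that have "component b (n - m) = \<zero>" by blast
      with a False show ?thesis by simp
    qed simp
    have "(\<Oplus>n\<in>(+) m ` ?S. ?f n) = (\<Oplus>n\<in>?S. ?f (m + n))"
      using a assms(2) by (intro add.finprod_reindex) auto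
    also have "\<dots> = (\<Oplus>n\<in>?S. a \<otimes> component b n)"
      by simp
    also have "\<dots> = a \<otimes> (\<Oplus>n\<in>?S. component b n)"
      using fin a assms(2) by (intro finsum_rdistr[symmetric]) auto
    also have "\<dots> = a \<otimes> b"
      using assms(2) fin by (simp add: finsum_component)
    finally show "(\<Oplus>n\<in>(+) m ` ?S. ?f n) = a \<otimes> b" .
  qed
  then show ?thesis by simp
qed

lemma additive_subgroup_memI:
  assumes "additive_subgroup H R" "r \<in> carrier R" "\<And>n. component r n \<in> H"
  shows "r \<in> H"
  using finsum_in_additive_subgroup[OF assms(1), of "{n. component r n \<noteq> \<zero>}" "component r"] assms
  by (simp add: finsum_component finite_support_component)

text \<open>With one factor fixed, the elements it multiplies into \<open>H\<close> form an additive
  subgroup. Decomposing first \<open>b\<close> and then \<open>a\<close> reduces the claim to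
  products of components.\<close>

lemma mult_in_additive_subgroup:
  assumes H: "additive_subgroup H R" and ab: "a \<in> carrier R" "b \<in> carrier R"
    and *: "\<And>i j. component a i \<otimes> component b j \<in> H"
  shows "a \<otimes> b \<in> H"
proof -
  interpret H: additive_subgroup H R by fact
  have sub: "additive_subgroup {x \<in> carrier R. c \<otimes> x \<in> H} R" if "c \<in> carrier R" for c
    using that by (intro additive_subgroupI) (auto simp: r_distr r_minus)
  have "component a i \<otimes> b \<in> H" for i
    using additive_subgroup_memI[OF sub[of "component a i"] ab(2)] ab * by auto
  then have *: "b \<otimes> component a i \<in> H" for i
    by (simp only: m_comm[OF ab(2) component_carrier[OF ab(1)]])
  have "a \<in> {x \<in> carrier R. b \<otimes> x \<in> H}"
    by (rule additive_subgroup_memI[OF sub[OF ab(2)] ab(1)]) (use ab * in simp)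
  then show ?thesis using ab by (simp add: m_comm)
qed

section \<open>Graded ideals and their closure properties\<close>

text \<open>The componentwise form of homogeneity, easier to check for colon ideals, products and
  unions than generation by homogeneous elements.\<close>

definition graded_ideal :: "'a set \<Rightarrow> bool" where
  "graded_ideal I \<longleftrightarrow> ideal I R \<and> (\<forall>r\<in>I. \<forall>n. component r n \<in> I)"

lemma graded_ideal_ideal: "graded_ideal I \<Longrightarrow> ideal I R"
  and graded_ideal_component: "graded_ideal I \<Longrightarrow> r \<in> I \<Longrightarrow> component r n \<in> I"
  by (auto simp: graded_ideal_def)

lemma additive_subgroup_components:
  assumes "ideal I R"
  shows "additive_subgroup {r \<in> carrier R. \<forall>n. component r n \<in> I} R"
proof -
  interpret ideal I R by fact
  show ?thesis
    by (intro additive_subgroupI) (auto simp: component_add component_minus)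
qed

text \<open>The elements whose components all lie in \<open>I\<close> form an ideal containing the
  homogeneous generators of \<open>I\<close>, hence containing \<open>I\<close>.\<close>

lemma homogeneous_ideal_imp_graded_ideal:
  assumes "homogeneous_ideal R gr I"
  shows "graded_ideal I"
proof -
  have I: "ideal I R" and gen: "I = Idl (I \<inter> (\<Union>n. gr n))"
    using assms by (auto simp: homogeneous_ideal_def)
  interpret ideal I R by fact
  let ?H = "{r \<in> carrier R. \<forall>n. component r n \<in> I}"
  have H: "additive_subgroup ?H R" by (rule additive_subgroup_components[OF I])
  have mult: "x \<otimes> a \<in> ?H" if "a \<in> ?H" "x \<in> carrier R" for a x
  proof (rule mult_in_additive_subgroup[OF H])
    fix i j
    have "component x i \<otimes> component a j \<in> I" "component a j \<in> carrier R"
      using that by (auto simp: I_l_closed)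
    then show "component x i \<otimes> component a j \<in> ?H"
      using that component_homogeneous[OF gr_mult[OF component_gr component_gr], of x a i j]
      by auto
  qed (use that in auto)
  have "ideal ?H R"
    by (rule idealI_left[OF H mult])
  moreover have "I \<inter> (\<Union>n. gr n) \<subseteq> ?H"
    by (auto simp: component_homogeneous)
  ultimately have "Idl (I \<inter> (\<Union>n. gr n)) \<subseteq> ?H"
    by (rule genideal_minimal)
  then show ?thesis using gen I unfolding graded_ideal_def by blast
qed

text \<open>Multiplication by the homogeneous \<open>a\<close> shifts components, so component
  \<open>n\<close> of \<open>r\<close> is tested by component \<open>n + m\<close> of
  \<open>a r\<close>.\<close>

lemma graded_ideal_colon:
  assumes "graded_ideal I" "a \<in> gr m"
  shows "graded_ideal (colon_ideal R I a)"
  unfolding graded_ideal_def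
proof (intro conjI ballI allI)
  have I: "ideal I R" by (rule graded_ideal_ideal) fact
  show "ideal (colon_ideal R I a) R"
    using assms I gr_carrier by (intro colon_ideal_ideal)
  fix r n assume "r \<in> colon_ideal R I a"
  then have r: "r \<in> carrier R" "a \<otimes> r \<in> I" by (auto simp: colon_ideal_def)
  have "component (a \<otimes> r) (n + m) = a \<otimes> component r n"
    using component_mult_homogeneous[OF assms(2) r(1), of "n + m"] by simp
  with graded_ideal_component[OF assms(1) r(2), of "n + m"] r(1)
  show "component r n \<in> colon_ideal R I a" by (simp add: colon_ideal_def)
qed

text \<open>The elements with all components in the product form an additive subgroup. A product
  \<open>a b\<close> lies in it because the products of components of \<open>a\<close> and
  \<open>b\<close> do.\<close>

lemma graded_ideal_prod:
  assumes "graded_ideal I" "graded_ideal J"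
  shows "graded_ideal (ideal_prod R I J)"
proof -
  interpret I: ideal I R by (rule graded_ideal_ideal) fact
  interpret J: ideal J R by (rule graded_ideal_ideal) fact
  interpret IJ: ideal "ideal_prod R I J" R
    by (intro ideal_prod_is_ideal I.is_ideal J.is_ideal)
  let ?H = "{r \<in> carrier R. \<forall>n. component r n \<in> ideal_prod R I J}"
  have H: "additive_subgroup ?H R" by (rule additive_subgroup_components[OF IJ.is_ideal])
  have "x \<in> ?H" if "x \<in> ideal_prod R I J" for x
    using that
  proof induction
    case (prod a b)
    show ?case
    proof (rule mult_in_additive_subgroup[OF H])
      fix i j
      have "component a i \<otimes> component b j \<in> ideal_prod R I J"
        using prod assms graded_ideal_component by (intro ideal_prod.prod)
      then show "component a i \<otimes> component b j \<in> ?H"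
        using prod component_homogeneous[OF gr_mult[OF component_gr component_gr], of a b i j]
        by auto
    qed (use prod in auto)
  next
    case (sum s1 s2)
    then show ?case using additive_subgroup.a_closed[OF H] by blast
  qed
  then show ?thesis using IJ.is_ideal by (auto simp: graded_ideal_def)
qed

lemma graded_ideal_carrier: "graded_ideal (carrier R)"
  by (simp add: graded_ideal_def oneideal)

lemma graded_ideal_power: "graded_ideal I \<Longrightarrow> graded_ideal (ideal_power R I n)"
  by (induction n) (auto simp: graded_ideal_carrier graded_ideal_prod)

section \<open>The filtration by lowest degree\<close>

text \<open>This filtration supports arguments with lowest-degree terms; its member for
  \<open>d = 1\<close> turns out to be the irrelevant ideal.\<close>

definition degree_ge :: "nat \<Rightarrow> 'a set" where
  "degree_ge d = {r \<in> carrier R. \<forall>k<d. component r k = \<zero>}"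

lemma degree_ge_mult:
  assumes "a \<in> degree_ge d" "b \<in> degree_ge e"
  shows "a \<otimes> b \<in> degree_ge (d + e)"
proof (rule mult_in_additive_subgroup)
  show "additive_subgroup (degree_ge (d + e)) R"
    by (intro additive_subgroupI) (auto simp: degree_ge_def component_add component_minus)
  show ab: "a \<in> carrier R" "b \<in> carrier R" using assms by (auto simp: degree_ge_def)
  fix i j
  show "component a i \<otimes> component b j \<in> degree_ge (d + e)"
  proof (cases "i < d \<or> j < e")
    case True
    then have "component a i \<otimes> component b j = \<zero>"
      using assms ab by (auto simp: degree_ge_def)
    then show ?thesis by (simp add: degree_ge_def)
  next
    case False
    then show ?thesis
      using ab component_homogeneous[OF gr_mult[OF component_gr[OF ab(1)] component_gr[OF ab(2)]], of i j]
      by (auto simp: degree_ge_def)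
  qed
qed

lemma ideal_degree_ge: "ideal (degree_ge d) R"
proof -
  have sub: "additive_subgroup (degree_ge d) R"
    by (intro additive_subgroupI) (auto simp: degree_ge_def component_add component_minus)
  have mult: "x \<otimes> a \<in> degree_ge d" if "a \<in> degree_ge d" "x \<in> carrier R" for a x
    using degree_ge_mult[of x 0 a d] that by (simp add: degree_ge_def)
  show ?thesis
    by (rule idealI_left[OF sub mult])
qed

lemma gr_subset_degree_ge: "d \<le> n \<Longrightarrow> gr n \<subseteq> degree_ge d"
  by (auto simp: degree_ge_def component_homogeneous gr_carrier)

lemma ideal_power_subset_degree_ge:
  assumes "I \<subseteq> degree_ge d"
  shows "ideal_power R I n \<subseteq> degree_ge (n * d)"
proof (induction n)
  case 0
  then show ?case by (simp add: degree_ge_def)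
next
  case (Suc n)
  then show ?case
    using degree_ge_mult[of _ d _ "n * d"] assms
    by (auto intro!: ideal_prod_subsetI[OF ideal_degree_ge])
qed

lemma minus_component_degree_ge:
  assumes "a \<in> degree_ge d"
  shows "a \<ominus> component a d \<in> degree_ge (Suc d)"
  using assms
  by (auto simp: degree_ge_def minus_eq component_add component_minus less_Suc_eq r_neg
      component_homogeneous[OF component_gr])

text \<open>Once the lowest components are split off, the remaining terms of the product start in
  degree \<open>d + e + 1\<close>.\<close>

lemma component_mult_lowest:
  assumes "a \<in> degree_ge d" "b \<in> degree_ge e"
  shows "component (a \<otimes> b) (d + e) = component a d \<otimes> component b e"
proof -
  have ab: "a \<in> carrier R" "b \<in> carrier R" using assms by (auto simp: degree_ge_def)
  define a' where "a' = a \<ominus> component a d"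
  define b' where "b' = b \<ominus> component b e"
  have "a' \<in> degree_ge (Suc d)" "b' \<in> degree_ge (Suc e)"
    unfolding a'_def b'_def by (intro minus_component_degree_ge assms)+
  moreover have "component a d \<in> degree_ge d"
    using gr_subset_degree_ge[of d d] component_gr[OF ab(1)] by blast
  ultimately have low: "component a d \<otimes> b' \<in> degree_ge (Suc (d + e))" "a' \<otimes> b \<in> degree_ge (Suc (d + e))"
    using degree_ge_mult[of "component a d" d b' "Suc e"] degree_ge_mult[of a' "Suc d" b e] assms
    by auto
  have "a \<otimes> b = component a d \<otimes> component b e \<oplus> (component a d \<otimes> b' \<oplus> a' \<otimes> b)"
    unfolding a'_def b'_def using ab component_carrier[OF ab(1), of d] component_carrier[OF ab(2), of e]
    by algebra
  then have "component (a \<otimes> b) (d + e) = component (component a d \<otimes> component b e) (d + e) \<oplus>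
      (component (component a d \<otimes> b') (d + e) \<oplus> component (a' \<otimes> b) (d + e))"
    using low ab by (simp add: component_add degree_ge_def)
  also have "\<dots> = component a d \<otimes> component b e"
    using low ab component_homogeneous[OF gr_mult[OF component_gr[OF ab(1)] component_gr[OF ab(2)]], of d e]
    by (simp add: degree_ge_def)
  finally show ?thesis .
qed

text \<open>The components of \<open>a\<close> below its first component outside \<open>P\<close>
  sum to an element of \<open>P\<close>. Subtracting them leaves \<open>a\<close> unchanged modulo
  \<open>P\<close> and makes its lowest term a nonmember.\<close>

lemma nonmember_lowest_component:
  assumes "graded_ideal P" "a \<in> carrier R" "a \<notin> P"
  obtains d a' where "a' \<in> degree_ge d" "a \<ominus> a' \<in> P" "component a' d \<notin> P"
proof -
  interpret P: ideal P R by (rule graded_ideal_ideal) fact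
  let ?S = "{n. component a n \<noteq> \<zero>}"
  have fin: "finite ?S" by (rule finite_support_component) fact
  have "\<exists>n. component a n \<notin> P"
    using additive_subgroup_memI[OF P.is_additive_subgroup assms(2)] assms(3) by blast
  define d where "d = (LEAST n. component a n \<notin> P)"
  have d: "component a d \<notin> P" unfolding d_def by (rule LeastI_ex) fact
  have below: "component a k \<in> P" if "k < d" for k
    using not_less_Least that unfolding d_def by blast
  define c where "c = (\<Oplus>k\<in>{..<d}. component a k)"
  have c: "c \<in> P"
    unfolding c_def using below by (intro finsum_in_additive_subgroup P.is_additive_subgroup) auto
  have cc: "component c n = (if n < d then component a n else \<zero>)" for n
  proof -
    have "component c = (\<lambda>n. if n < d then component a n else \<zero>)"
    proof (rule component_unique)
      show "(\<Oplus>n\<in>{..<d}. if n < d then component a n else \<zero>) = c"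
        unfolding c_def using assms(2) by (intro finsum_cong') auto
    qed (use assms(2) component_gr in auto)
    then show ?thesis by simp
  qed
  have comp: "component (a \<ominus> c) n = (if n < d then \<zero> else component a n)" for n
    using assms(2) c by (simp add: minus_eq component_add component_minus cc r_neg)
  show ?thesis
  proof
    show "a \<ominus> c \<in> degree_ge d" using assms(2) c comp by (simp add: degree_ge_def)
    have "a \<ominus> (a \<ominus> c) = c" using assms(2) P.Icarr[OF c] by algebra
    with c show "a \<ominus> (a \<ominus> c) \<in> P" by simp
    show "component (a \<ominus> c) d \<notin> P" using d comp by simp
  qed
qed

text \<open>Replace two nonmembers by representatives modulo \<open>P\<close> whose lowest terms lie
  outside \<open>P\<close>. If their product were in \<open>P\<close>, so would be its lowest term,
  the product of two homogeneous nonmembers.\<close>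

lemma primeideal_gradedI:
  assumes P: "graded_ideal P" "P \<noteq> carrier R"
    and prime: "\<And>a b m n. a \<in> gr m \<Longrightarrow> b \<in> gr n \<Longrightarrow> a \<otimes> b \<in> P \<Longrightarrow> a \<in> P \<or> b \<in> P"
  shows "primeideal P R"
proof (rule primeidealI[OF graded_ideal_ideal[OF P(1)] is_cring])
  interpret P: ideal P R by (rule graded_ideal_ideal) fact
  fix a b assume ab: "a \<in> carrier R" "b \<in> carrier R" "a \<otimes> b \<in> P"
  show "a \<in> P \<or> b \<in> P"
  proof (rule ccontr)
    assume "\<not> (a \<in> P \<or> b \<in> P)"
    then obtain d a' e b' where a': "a' \<in> degree_ge d" "a \<ominus> a' \<in> P" "component a' d \<notin> P"
      and b': "b' \<in> degree_ge e" "b \<ominus> b' \<in> P" "component b' e \<notin> P"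
      using nonmember_lowest_component[OF P(1)] ab by metis
    have c: "a' \<in> carrier R" "b' \<in> carrier R" using a' b' by (auto simp: degree_ge_def)
    have "a' \<otimes> b' = a \<otimes> b \<ominus> ((a \<ominus> a') \<otimes> b \<oplus> a' \<otimes> (b \<ominus> b'))"
      using ab c by algebra
    also have "\<dots> \<in> P"
      by (subst minus_eq)
        (intro P.a_closed P.a_inv_closed P.I_l_closed P.I_r_closed ab a'(2) b'(2) c)
    finally have "component (a' \<otimes> b') (d + e) \<in> P"
      by (rule graded_ideal_component[OF P(1)])
    then have "component a' d \<otimes> component b' e \<in> P"
      using component_mult_lowest[OF a'(1) b'(1)] by simp
    with prime[OF component_gr[OF c(1)] component_gr[OF c(2)]] a'(3) b'(3) show False by blast
  qed
qed (use P(2) in auto)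

section \<open>The irrelevant ideal and graded primes\<close>

lemma irrelevant_ideal_eq: "irrelevant_ideal R gr = degree_ge 1"
proof
  have sub: "(\<Union>n\<in>{1..}. gr n) \<subseteq> carrier R" using gr_carrier by auto
  show "irrelevant_ideal R gr \<subseteq> degree_ge 1"
    unfolding irrelevant_ideal_def using gr_subset_degree_ge
    by (intro genideal_minimal ideal_degree_ge) fastforce
  interpret m: ideal "irrelevant_ideal R gr" R
    unfolding irrelevant_ideal_def by (rule genideal_ideal[OF sub])
  show "degree_ge 1 \<subseteq> irrelevant_ideal R gr"
  proof
    fix r assume "r \<in> degree_ge 1"
    then have r: "r \<in> carrier R" "component r 0 = \<zero>" by (auto simp: degree_ge_def)
    show "r \<in> irrelevant_ideal R gr"
    proof (rule additive_subgroup_memI[OF m.is_additive_subgroup r(1)])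
      fix n
      show "component r n \<in> irrelevant_ideal R gr"
      proof (cases "n = 0")
        case False
        then have "component r n \<in> (\<Union>n\<in>{1..}. gr n)"
          using component_gr[OF r(1), of n] by auto
        then show ?thesis
          unfolding irrelevant_ideal_def using genideal_self[OF sub] by blast
      qed (simp add: r)
    qed
  qed
qed

lemma one_gr_0: "\<one> \<in> gr 0"
  using subringE(3)[OF subfieldE(1)[OF subfield_K]] by (simp add: gr_0)

text \<open>Modulo the ideal of the linear generators every element of the algebra is congruent to a
  constant, by induction on how it is generated from \<open>K\<close> and \<open>X\<close>. In
  positive degree that constant vanishes.\<close>

lemma degree_ge_1_generated:
  obtains X where "finite X" "X \<subseteq> gr 1" "degree_ge 1 = Idl X"
proof -
  obtain X where X: "finite X" "X \<subseteq> gr 1" "generate_ring R (K \<union> X) = carrier R"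
    using gr_1_generates by blast
  have Xc: "X \<subseteq> carrier R" using X gr_carrier by blast
  interpret I: ideal "Idl X" R by (rule genideal_ideal[OF Xc])
  interpret gr0: additive_subgroup "gr 0" R by (rule gr_subgroup)
  have low: "Idl X \<subseteq> degree_ge 1"
    using X(2) gr_subset_degree_ge[of 1 1] by (intro genideal_minimal ideal_degree_ge) auto
  have split: "\<exists>c\<in>gr 0. r \<ominus> c \<in> Idl X" if "r \<in> generate_ring R (K \<union> X)" for r
    using that
  proof induction
    case one
    show ?case using one_gr_0 by (intro bexI[of _ \<one>]) (auto simp: minus_eq r_neg)
  next
    case (incl h)
    then show ?case
    proof
      assume "h \<in> K"
      then show ?thesis
        using gr_carrier[of h 0] by (intro bexI[of _ h]) (auto simp: minus_eq r_neg gr_0)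
    next
      assume "h \<in> X"
      then show ?thesis
        using genideal_self[OF Xc] Xc by (intro bexI[of _ \<zero>]) (auto simp: minus_eq)
    qed
  next
    case (a_inv h)
    then obtain c where c: "c \<in> gr 0" "h \<ominus> c \<in> Idl X" by blast
    have h: "h \<in> carrier R" using a_inv X(3) by simp
    have cc: "c \<in> carrier R" using c gr_carrier by blast
    have "\<ominus> h \<ominus> (\<ominus> c) = \<ominus> (h \<ominus> c)" using h cc by algebra
    then show ?case using c by (intro bexI[of _ "\<ominus> c"]) auto
  next
    case (eng_add r s)
    then obtain c d where cd: "c \<in> gr 0" "r \<ominus> c \<in> Idl X" "d \<in> gr 0" "s \<ominus> d \<in> Idl X" by blast
    have h: "r \<in> carrier R" "s \<in> carrier R" using eng_add X(3) by auto
    have cc: "c \<in> carrier R" "d \<in> carrier R" using cd gr_carrier by blast+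
    have "(r \<oplus> s) \<ominus> (c \<oplus> d) = (r \<ominus> c) \<oplus> (s \<ominus> d)" using h cc by algebra
    then show ?case using cd by (intro bexI[of _ "c \<oplus> d"]) auto
  next
    case (eng_mult r s)
    then obtain c d where cd: "c \<in> gr 0" "r \<ominus> c \<in> Idl X" "d \<in> gr 0" "s \<ominus> d \<in> Idl X" by blast
    have h: "r \<in> carrier R" "s \<in> carrier R" using eng_mult X(3) by auto
    have cc: "c \<in> carrier R" "d \<in> carrier R" using cd gr_carrier by blast+
    have "(r \<otimes> s) \<ominus> (c \<otimes> d) = (r \<ominus> c) \<otimes> s \<oplus> c \<otimes> (s \<ominus> d)" using h cc by algebra
    then show ?case using cd h cc gr_mult[of c 0 d 0]
      by (intro bexI[of _ "c \<otimes> d"]) (auto simp: I.I_l_closed I.I_r_closed)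
  qed
  have "degree_ge 1 \<subseteq> Idl X"
  proof
    fix r assume r: "r \<in> degree_ge 1"
    then have rc: "r \<in> carrier R" by (simp add: degree_ge_def)
    obtain c where c: "c \<in> gr 0" "r \<ominus> c \<in> Idl X" using split rc X(3) by blast
    have cc: "c \<in> carrier R" using c gr_carrier by blast
    \<comment> \<open>Degree 0 is computed twice: \<open>r - c\<close> lies in \<open>Idl X\<close>,
      which has no constants, while \<open>r\<close> itself contributes nothing.\<close>
    have "component (r \<ominus> c) 0 = \<zero>" using c(2) low by (auto simp: degree_ge_def)
    moreover have "component (r \<ominus> c) 0 = \<ominus> c"
      using r rc cc c(1) by (simp add: minus_eq component_add component_minus degree_ge_def component_homogeneous)
    ultimately have "c = \<zero>" using cc by (metis minus_minus minus_zero)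
    then show "r \<in> Idl X" using c(2) rc by (simp add: minus_eq)
  qed
  with low X that show ?thesis by blast
qed

text \<open>A nonzero degree-0 component would be a unit, since degree 0 is the field
  \<open>K\<close>.\<close>

lemma graded_ideal_subset_degree_ge_1:
  assumes "graded_ideal P" "P \<noteq> carrier R"
  shows "P \<subseteq> degree_ge 1"
proof
  interpret P: ideal P R by (rule graded_ideal_ideal) fact
  fix r assume r: "r \<in> P"
  then have rc: "r \<in> carrier R" by simp
  have "component r 0 = \<zero>"
  proof (rule ccontr)
    let ?c = "component r 0"
    assume "?c \<noteq> \<zero>"
    then have c: "?c \<in> K - {\<zero>}" using component_gr[OF rc, of 0] by (simp add: gr_0)
    have "inv ?c \<in> carrier R"
      using subfield_m_inv(1)[OF subfield_K c] gr_carrier[of _ 0] by (auto simp: gr_0)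
    then have "inv ?c \<otimes> ?c \<in> P"
      using graded_ideal_component[OF assms(1) r] by (simp add: P.I_l_closed)
    then show False
      using subfield_m_inv(3)[OF subfield_K c] P.one_imp_carrier assms(2) by simp
  qed
  then show "r \<in> degree_ge 1" using rc by (simp add: degree_ge_def)
qed

text \<open>Degree-0 components multiply, and one of them vanishes if their product does. The
  irrelevant ideal will be the top of a chain of primes.\<close>

lemma primeideal_degree_ge_1:
  assumes "domain R"
  shows "primeideal (degree_ge 1) R"
proof (rule primeidealI[OF ideal_degree_ge is_cring])
  interpret domain R by fact
  show "carrier R \<noteq> degree_ge 1"
  proof
    assume "carrier R = degree_ge 1"
    then have "component \<one> 0 = \<zero>" by (auto simp: degree_ge_def)
    then show False using component_homogeneous[OF one_gr_0, of 0] by simp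
  qed
  fix a b assume ab: "a \<in> carrier R" "b \<in> carrier R" "a \<otimes> b \<in> degree_ge 1"
  then have "component a 0 \<otimes> component b 0 = \<zero>"
    using component_mult_lowest[of a 0 b 0] by (simp add: degree_ge_def)
  then show "a \<in> degree_ge 1 \<or> b \<in> degree_ge 1"
    using ab integral by (auto simp: degree_ge_def)
qed

lemma pow_gr: "x \<in> gr m \<Longrightarrow> x [^] (k::nat) \<in> gr (k * m)"
proof (induction k)
  case (Suc k)
  then show ?case using gr_mult[of "x [^] k" "k * m" x m] by (simp add: add.commute)
qed (simp add: one_gr_0)

section \<open>Existence of graded primes and the dimension argument\<close>

lemma graded_ideal_Union_chain:
  assumes "\<C> \<noteq> {}" "\<And>P. P \<in> \<C> \<Longrightarrow> graded_ideal P" "\<And>P Q. P \<in> \<C> \<Longrightarrow> Q \<in> \<C> \<Longrightarrow> P \<subseteq> Q \<or> Q \<subseteq> P"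
  shows "graded_ideal (\<Union>\<C>)"
proof -
  note id = graded_ideal_ideal[OF assms(2)]
  have "additive_subgroup (\<Union>\<C>) R"
  proof (rule additive_subgroupI)
    show "\<Union>\<C> \<subseteq> carrier R" using ideal.Icarr[OF id] by blast
    show "\<zero> \<in> \<Union>\<C>"
      using assms(1) additive_subgroup.zero_closed[OF ideal.axioms(1)[OF id]] by blast
    show "\<ominus> x \<in> \<Union>\<C>" if "x \<in> \<Union>\<C>" for x
      using that additive_subgroup.a_inv_closed[OF ideal.axioms(1)[OF id]] by blast
    fix x y assume "x \<in> \<Union>\<C>" "y \<in> \<Union>\<C>"
    then obtain Q where "Q \<in> \<C>" "x \<in> Q" "y \<in> Q" using assms(3) by blast
    then show "x \<oplus> y \<in> \<Union>\<C>"
      using additive_subgroup.a_closed[OF ideal.axioms(1)[OF id]] by blast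
  qed
  then have "ideal (\<Union>\<C>) R"
    by (rule idealI_left) (use ideal.I_l_closed[OF id] in blast)
  then show ?thesis
    using graded_ideal_component[OF assms(2)] by (auto simp: graded_ideal_def)
qed

text \<open>Graded form of a classical fact: by Zorn's lemma there is a maximal graded ideal among
  those above \<open>I\<close> that contain no power of \<open>x\<close>, and it is prime.\<close>

lemma exists_graded_prime_avoiding:
  assumes I: "graded_ideal I" and x: "x \<in> gr m" and "\<And>k::nat. x [^] k \<notin> I"
  obtains P where "graded_ideal P" "primeideal P R" "I \<subseteq> P" "x \<notin> P"
proof -
  define \<A> where "\<A> = {P. graded_ideal P \<and> I \<subseteq> P \<and> (\<forall>k::nat. x [^] k \<notin> P)}"
  have xc: "x \<in> carrier R" using x gr_carrier by blast
  have "\<exists>P\<in>\<A>. \<forall>Q\<in>\<A>. P \<subseteq> Q \<longrightarrow> Q = P"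
  proof (rule subset_Zorn_nonempty)
    show "\<A> \<noteq> {}" using assms by (auto simp: \<A>_def)
    fix \<C> assume C: "\<C> \<noteq> {}" "subset.chain \<A> \<C>"
    then have sub: "\<C> \<subseteq> \<A>" and total: "\<And>P Q. P \<in> \<C> \<Longrightarrow> Q \<in> \<C> \<Longrightarrow> P \<subseteq> Q \<or> Q \<subseteq> P"
      by (auto simp: subset_chain_def)
    have "graded_ideal (\<Union>\<C>)"
      by (rule graded_ideal_Union_chain[OF C(1) _ total]) (use sub in \<open>auto simp: \<A>_def\<close>)
    with C(1) sub show "\<Union>\<C> \<in> \<A>" unfolding \<A>_def by blast
  qed
  then obtain P where "P \<in> \<A>" and max: "\<And>Q. Q \<in> \<A> \<Longrightarrow> P \<subseteq> Q \<Longrightarrow> Q = P" by blast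
  then have P: "graded_ideal P" "I \<subseteq> P" "\<And>k::nat. x [^] k \<notin> P" by (auto simp: \<A>_def)
  \<comment> \<open>Otherwise \<open>(P : c)\<close> would be a strictly larger member of \<open>\<A>\<close>.\<close>
  have meets: "\<exists>k::nat. c \<otimes> x [^] k \<in> P"
    if c: "c \<in> gr i" "d \<in> carrier R" "c \<otimes> d \<in> P" "d \<notin> P" for c d i
  proof (rule ccontr)
    assume "\<not> (\<exists>k::nat. c \<otimes> x [^] k \<in> P)"
    moreover have sub: "P \<subseteq> colon_ideal R P c"
      using c(1) gr_carrier by (intro subset_colon_ideal graded_ideal_ideal P) auto
    ultimately have "colon_ideal R P c \<in> \<A>"
      using P(2) graded_ideal_colon[OF P(1) c(1)] by (auto simp: \<A>_def colon_ideal_def)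
    then have "colon_ideal R P c = P" using sub by (rule max)
    with c show False by (auto simp: colon_ideal_def)
  qed
  have "primeideal P R"
  proof (rule primeideal_gradedI[OF P(1)])
    show "P \<noteq> carrier R" using P(3)[of 0] by auto
    fix a b i j assume ab: "a \<in> gr i" "b \<in> gr j" "a \<otimes> b \<in> P"
    have abc: "a \<in> carrier R" "b \<in> carrier R" using ab gr_carrier by blast+
    show "a \<in> P \<or> b \<in> P"
    proof (rule ccontr)
      assume neg: "\<not> (a \<in> P \<or> b \<in> P)"
      \<comment> \<open>\<open>meets\<close> is used twice: first \<open>b\<close> is traded for a
        power of \<open>x\<close>, then \<open>a\<close>, with \<open>x^k\<close> as the homogeneous
        factor. A power of \<open>x\<close> thus lands in \<open>P\<close>.\<close>
      then obtain k :: nat where "a \<otimes> x [^] k \<in> P" using meets[OF ab(1) abc(2) ab(3)] by blast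
      then have "x [^] k \<otimes> a \<in> P" using abc xc by (simp add: m_comm)
      then obtain l :: nat where "x [^] k \<otimes> x [^] l \<in> P"
        using meets[OF pow_gr[OF x] abc(1)] neg by blast
      then show False using P(3)[of "k + l"] xc by (simp add: nat_pow_mult)
    qed
  qed
  with P P(3)[of 1] xc that show ?thesis by auto
qed

text \<open>If no power of a linear generator \<open>x\<close> lay in the colon ideal, a graded
  prime \<open>P\<close> avoiding \<open>x\<close> would lie strictly between \<open>p\<close> and
  the irrelevant ideal. The exponents of the finitely many generators then bound one power of the
  irrelevant ideal.\<close>

lemma irrelevant_power_mult_symbolic_power:
  assumes "domain R" and p: "primeideal p R" "graded_ideal p" and dim: "krull_dim (R Quot p) \<le> 1"
    and r: "r \<in> gr a" "r \<in> symbolic_power R p n"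
  obtains k where "\<And>t. t \<in> ideal_power R (irrelevant_ideal R gr) k \<Longrightarrow> t \<otimes> r \<in> ideal_power R p n"
proof -
  interpret p: primeideal p R by fact
  let ?I = "colon_ideal R (ideal_power R p n) r"
  have rc: "r \<in> carrier R" using r gr_carrier by blast
  have I: "graded_ideal ?I"
    by (intro graded_ideal_colon[OF _ r(1)] graded_ideal_power p)
  obtain s where s: "s \<in> carrier R" "s \<notin> p" "s \<otimes> r \<in> ideal_power R p n"
    using r(2) by (auto simp: symbolic_power_prime[OF p(1)])
  then have sI: "s \<in> ?I" using rc by (simp add: colon_ideal_def m_comm)
  have pI: "ideal_power R p n \<subseteq> ?I"
    by (intro subset_colon_ideal ideal_ideal_power p.is_ideal rc)
  obtain X where X: "finite X" "X \<subseteq> gr 1" "degree_ge 1 = Idl X"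
    by (rule degree_ge_1_generated)
  have "\<exists>k::nat. x [^] k \<in> ?I" if "x \<in> X" for x
  proof (rule ccontr)
    assume "\<nexists>k::nat. x [^] k \<in> ?I"
    moreover have x: "x \<in> gr 1" using that X by blast
    ultimately obtain P where P: "graded_ideal P" "primeideal P R" "?I \<subseteq> P" "x \<notin> P"
      using exists_graded_prime_avoiding[OF I x] by blast
    have "p \<subseteq> P"
      using ideal_power_subset_prime[OF P(2) p.is_ideal] pI P(3) by blast
    \<comment> \<open>The multiplier \<open>s\<close> lies in the colon ideal, hence in
      \<open>P\<close>, but not in \<open>p\<close>.\<close>
    then have "p \<subset> P" using s(2) sI P(3) by blast
    moreover have "P \<subseteq> degree_ge 1"
      using primeideal.I_notcarr[OF P(2)] by (intro graded_ideal_subset_degree_ge_1[OF P(1)]) auto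
    then have "P \<subset> degree_ge 1"
      using P(4) x gr_subset_degree_ge[of 1 1] by blast
    ultimately have "2 \<le> krull_dim (R Quot p)"
      by (rule krull_dim_quotient_ge_2[OF p(1) P(2) primeideal_degree_ge_1[OF assms(1)]])
    then have "(2::enat) \<le> 1" using dim by (rule order_trans)
    then show False by (simp add: numeral_eq_enat one_enat_def)
  qed
  then obtain N where N: "\<And>x. x \<in> X \<Longrightarrow> x [^] (N x :: nat) \<in> ?I" by metis
  have "X \<subseteq> carrier R" using X(2) gr_carrier by blast
  then have sub: "ideal_power R (Idl X) (Suc (sum N X)) \<subseteq> ?I"
    by (intro ideal_power_genideal_subset[OF X(1) _ graded_ideal_ideal[OF I] N refl])
  show ?thesis
  proof (rule that)
    fix t assume "t \<in> ideal_power R (irrelevant_ideal R gr) (Suc (sum N X))"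
    then have "t \<in> ?I" using sub unfolding irrelevant_ideal_eq X(3) by blast
    then show "t \<otimes> r \<in> ideal_power R p n" using rc by (simp add: colon_ideal_def m_comm)
  qed
qed

section \<open>Initial degrees and the Waldschmidt constant\<close>

lemma initial_degree_le:
  assumes "r \<in> I" "r \<in> gr n" "r \<noteq> \<zero>"
  shows "initial_degree R gr I \<le> n"
  unfolding initial_degree_def by (rule Least_le) (use assms in auto)

text \<open>With \<open>\<zero> \<in> I\<close> the intersection with a graded piece is never empty,
  so differing from \<open>{\<zero>}\<close> means containing a nonzero element.\<close>

lemma initial_degree_attained:
  assumes "\<zero> \<in> I" "r \<in> I" "r \<in> gr n" "r \<noteq> \<zero>"
  obtains s where "s \<in> I" "s \<in> gr (initial_degree R gr I)" "s \<noteq> \<zero>"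
proof -
  have "I \<inter> gr (initial_degree R gr I) \<noteq> {\<zero>}"
    unfolding initial_degree_def by (rule LeastI[of _ n]) (use assms in auto)
  moreover have "\<zero> \<in> I \<inter> gr (initial_degree R gr I)" using assms(1) by simp
  ultimately show ?thesis using that by blast
qed

lemma graded_ideal_subset_degree_ge_initial_degree:
  assumes "graded_ideal I"
  shows "I \<subseteq> degree_ge (initial_degree R gr I)"
proof
  fix r assume r: "r \<in> I"
  then have rc: "r \<in> carrier R" using ideal.Icarr[OF graded_ideal_ideal[OF assms]] by blast
  have "component r k = \<zero>" if "k < initial_degree R gr I" for k
    using initial_degree_le[OF graded_ideal_component[OF assms r] component_gr[OF rc], of k] that by force
  then show "r \<in> degree_ge (initial_degree R gr I)" using rc by (simp add: degree_ge_def)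
qed

lemma waldschmidt_ge:
  assumes "domain R" and p: "primeideal p R" "graded_ideal p" "p \<noteq> {\<zero>}"
    and dim: "krull_dim (R Quot p) \<le> 1"
    and b: "\<forall>\<^sub>F n in sequentially. \<forall>r\<in>ideal_power R (irrelevant_ideal R gr) (b * n).
      \<forall>x\<in>local_cohomology_0 R (irrelevant_ideal R gr) (quotient_module R (ideal_power R p n)).
        r \<odot>\<^bsub>quotient_module R (ideal_power R p n)\<^esub> x = \<zero>\<^bsub>quotient_module R (ideal_power R p n)\<^esub>"
  shows "waldschmidt R gr p \<ge> real (initial_degree R gr p) - real b"
proof -
  interpret domain R by fact
  interpret p: primeideal p R by fact
  let ?m = "irrelevant_ideal R gr"
  define \<alpha> where "\<alpha> = initial_degree R gr p"
  define f where "f n = initial_degree R gr (symbolic_power R p n)" for n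
  have m: "ideal ?m R" unfolding irrelevant_ideal_eq by (rule ideal_degree_ge)
  have pow_nz: "y [^] k \<noteq> \<zero>" if "y \<in> carrier R" "y \<noteq> \<zero>" for y and k :: nat
    by (induction k) (use that integral in auto)
  obtain h where h: "h \<in> p" "h \<noteq> \<zero>" using p(3) p.zero_closed by blast
  have hc: "h \<in> carrier R" using h by simp
  have "\<exists>i. component h i \<noteq> \<zero>"
    using additive_subgroup_memI[OF ideal.axioms(1)[OF zeroideal] hc] h(2) by blast
  then obtain i where g: "component h i \<noteq> \<zero>" by blast
  \<comment> \<open>A nonzero homogeneous element of \<open>p\<close>; its powers show that each
    symbolic power has a well-defined initial degree.\<close>
  define g where "g = component h i"
  have g: "g \<in> p" "g \<in> gr i" "g \<noteq> \<zero>"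
    using graded_ideal_component[OF p(2) h(1)] component_gr[OF hc] g by (auto simp: g_def)
  have "p \<subseteq> degree_ge 1"
    using p.I_notcarr by (intro graded_ideal_subset_degree_ge_1 p) auto
  obtain X where X: "finite X" "X \<subseteq> gr 1" "degree_ge 1 = Idl X"
    by (rule degree_ge_1_generated)
  \<comment> \<open>If all linear generators vanished, the irrelevant ideal, and with it
    \<open>p\<close>, would be zero.\<close>
  have "\<not> X \<subseteq> {\<zero>}"
    using genideal_minimal[OF zeroideal, of X] X(3) \<open>p \<subseteq> degree_ge 1\<close> h by blast
  then obtain x where x: "x \<in> gr 1" "x \<noteq> \<zero>" using X(2) by blast
  have xc: "x \<in> carrier R" using x gr_carrier by blast
  have xm: "x \<in> ?m" using x gr_subset_degree_ge[of 1 1] by (auto simp: irrelevant_ideal_eq)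

  have zero_sym: "\<zero> \<in> symbolic_power R p n" for n
    using ideal_power_subset_symbolic_power[OF p(1)]
      additive_subgroup.zero_closed[OF ideal.axioms(1)[OF ideal_ideal_power[OF p.is_ideal]]] by blast
  have "\<exists>s. s \<in> symbolic_power R p n \<and> s \<in> gr (f n) \<and> s \<noteq> \<zero>" for n
  proof -
    have "g [^] n \<in> symbolic_power R p n"
      using pow_in_ideal_power[OF p.is_ideal g(1)] ideal_power_subset_symbolic_power[OF p(1)] by blast
    then show ?thesis
      unfolding f_def using initial_degree_attained[OF zero_sym _ pow_gr[OF g(2)] pow_nz] g by (metis p.Icarr)
  qed
  then obtain s where s: "\<And>n. s n \<in> symbolic_power R p n" "\<And>n. s n \<in> gr (f n)" "\<And>n. s n \<noteq> \<zero>"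
    by metis
  have sc: "s n \<in> carrier R" for n using s(2) gr_carrier by blast

  have "f (m + n) \<le> f m + f n" for m n
    unfolding f_def[of "m + n"]
    by (rule initial_degree_le[OF symbolic_power_mult[OF p(1) s(1) s(1)] gr_mult[OF s(2) s(2)]])
      (use integral sc s(3) in blast)
  then have "convergent (\<lambda>n. real (f n) / real n)"
    by (intro subadditive_quotient_convergent) (auto simp flip: of_nat_add)
  \<comment> \<open>\<open>lim\<close> names the limit once convergence is known, which ties
    \<open>waldschmidt\<close> to the sequence.\<close>
  then have lim: "(\<lambda>n. real (f n) / real n) \<longlonglongrightarrow> waldschmidt R gr p"
    unfolding waldschmidt_def f_def by (simp add: convergent_LIMSEQ_iff)

  have "\<forall>\<^sub>F n in sequentially. n * \<alpha> \<le> b * n + f n"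
    using b
  proof eventually_elim
    case (elim n)
    let ?M = "quotient_module R (ideal_power R p n)"
    have pn: "ideal (ideal_power R p n) R" by (rule ideal_ideal_power[OF p.is_ideal])
    obtain k where "\<And>t. t \<in> ideal_power R ?m k \<Longrightarrow> t \<otimes> s n \<in> ideal_power R p n"
      using irrelevant_power_mult_symbolic_power[OF assms(1) p(1,2) dim s(2) s(1)] by blast
    then have "ideal_power R p n +> s n \<in> local_cohomology_0 R ?m ?M"
      by (rule local_cohomology_0_quotientI[OF pn m sc])
    moreover have "x [^] (b * n) \<in> ideal_power R ?m (b * n)"
      by (rule pow_in_ideal_power[OF m xm])
    \<comment> \<open>Admissibility of \<open>b\<close>, applied to the class of \<open>s n\<close>
      in the local cohomology and to the element \<open>x^(b n)\<close>.\<close>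
    ultimately have "x [^] (b * n) \<otimes> s n \<in> ideal_power R p n"
      using elim quotient_module_smult_eq_zero_iff[OF pn nat_pow_closed[OF xc] sc] by blast
    then have low: "x [^] (b * n) \<otimes> s n \<in> degree_ge (n * \<alpha>)"
      using ideal_power_subset_degree_ge[OF graded_ideal_subset_degree_ge_initial_degree[OF p(2)]]
      unfolding \<alpha>_def by blast
    have gr: "x [^] (b * n) \<otimes> s n \<in> gr (b * n + f n)"
      using gr_mult[OF pow_gr[OF x(1)] s(2), of "b * n" n] by simp
    have "x [^] (b * n) \<otimes> s n \<noteq> \<zero>"
      using integral pow_nz[OF xc x(2)] s(3) xc sc by blast
    \<comment> \<open>A nonzero homogeneous element has its own degree as lowest degree, while
      elements of \<open>p^n\<close> start in degree \<open>n \<alpha>\<close> at the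
      earliest.\<close>
    then have "component (x [^] (b * n) \<otimes> s n) (b * n + f n) \<noteq> \<zero>"
      using component_homogeneous[OF gr, of "b * n + f n"] by simp
    then show "n * \<alpha> \<le> b * n + f n"
      using low by (auto simp: degree_ge_def not_less[symmetric])
  qed
  then have "\<forall>\<^sub>F n in sequentially. real \<alpha> - real b \<le> real (f n) / real n"
    using eventually_gt_at_top[of 0]
  proof eventually_elim
    case (elim n)
    from elim(1) have "real (n * \<alpha>) \<le> real (b * n + f n)" by (rule of_nat_mono)
    with elim(2) show ?case by (simp add: field_simps)
  qed
  then have "real \<alpha> - real b \<le> waldschmidt R gr p"
    using lim by (intro tendsto_lowerbound[of _ _ sequentially]) auto
  then show ?thesis by (simp add: \<alpha>_def)
qed

end

theorem proposition9p4:
  fixes R :: "('a, 'b) ring_scheme" and K :: "'a set" and gr :: "nat \<Rightarrow> 'a set" and p :: "'a set"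
  assumes "standard_graded_algebra R K gr"
    and "domain R"
    and "primeideal p R"
    and "homogeneous_ideal R gr p"
    and "p \<noteq> {\<zero>\<^bsub>R\<^esub>}"
    and "krull_dim (R Quot p) = 1"
  shows "ereal (waldschmidt R gr p) \<ge>
    ereal (real (initial_degree R gr p)) - ereal_of_enat (sat_slope R gr p)"
proof -
  interpret standard_graded_algebra R K gr by fact
  show ?thesis
  proof (cases rule: sat_slope_cases[of R gr p])
    \<comment> \<open>For infinite slope the lower bound is \<open>-\<infinity>\<close> in
      \<open>ereal\<close>.\<close>
    case 1
    then show ?thesis by simp
  next
    case (2 b)
    have "waldschmidt R gr p \<ge> real (initial_degree R gr p) - real b"
      using assms 2(2) by (intro waldschmidt_ge homogeneous_ideal_imp_graded_ideal) auto
    then show ?thesis unfolding 2(1) by simp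
  qed
qed

end
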